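(* Let $q_0$ be a power of $2$, $q=2q_0^2$, and let $X$ be the Suzuki curve $y^q+y=x^{q_0}(x^q+x)$ over $\mathbb{F}_q$ (genus $g=q_0(q-1)$). Let $P,Q$ be distinct rational points, $m=q+2q_0+1$, and let $H$ be the divisor class of $mP\sim mQ$. Put $E_0=H-(2q_0+1)P-Q$, $E_1=H-(q_0+1)(P+Q)$, $E_2=H-P-(2q_0+1)Q$. Then the set $\mathcal{D}_0(P,Q)$ consists of exactly $m$ pairwise inequivalent divisor classes, represented by \[ iE_0+jE_2\ (0\leq i,j\leq q_0)\quad\text{and}\quad E_1+i'E_0+j'E_2\ (0\leq i',j'\leq q_0-1). \] These representatives correspond one-to-one to the $m$ divisors \[ E(a,b)=(a+q_0)H-((a+q_0)(q_0+1)+bq_0)P-((a+q_0)(q_0+1)-bq_0)Q,\qquad |a|+|b|\leq q_0 . \]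
   Context: For a divisor $E$, $L(E)=\{f:(f)+E\geq 0\}\cup\{0\}$. For distinct rational points $P,Q$, the set of discrepancies $\mathcal{D}(P,Q)$ is the set of divisor classes $A$ with $L(A)\neq L(A-P)$ and $L(A-Q)=L(A-Q-P)$ (equivalently $L(A)\neq L(A-Q)$ and $L(A-P)=L(A-P-Q)$), and $\mathcal{D}_0(P,Q)=\mathcal{D}(P,Q)\cap\{iP+jQ : i,j\in\mathbb{Z}\}$. On the Suzuki curve, for any two rational points $P,Q$ there is a function with divisor $m(P-Q)$, so $mP\sim mQ$; the canonical class is $K\sim 2(q_0-1)H$. *)

theory Defs
  imports "HOL-Library.Poly_Mapping" "HOL-Computational_Algebra.Polynomial"
begin

definition is_subfield :: "'f::field set \<Rightarrow> bool" where
  "is_subfield K \<longleftrightarrow> 0 \<in> K \<and> 1 \<in> K \<and>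
     (\<forall>a\<in>K. \<forall>b\<in>K. a + b \<in> K \<and> a * b \<in> K) \<and>
     (\<forall>a\<in>K. - a \<in> K \<and> inverse a \<in> K)"

definition transcendental_over :: "'f::field set \<Rightarrow> 'f \<Rightarrow> bool" where
  "transcendental_over K x \<longleftrightarrow>
     (\<forall>p. (\<forall>i. poly.coeff p i \<in> K) \<and> poly p x = 0 \<longrightarrow> p = 0)"

text \<open>
  The ambient field type is the function field \<open>K(x, y)\<close> of the Suzuki curve over
  the field \<open>K\<close> with \<open>q = 2 q0\<^sup>2\<close> elements.  As the defining equation is irreducible
  over \<open>K(x)\<close>, these conditions determine the triple up to isomorphism.
\<close>

definition suzuki_function_field :: "nat \<Rightarrow> 'f::field set \<Rightarrow> 'f \<Rightarrow> 'f \<Rightarrow> bool" where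
  "suzuki_function_field q0 K x y \<longleftrightarrow>
     is_subfield K \<and> card K = 2 * q0 ^ 2 \<and>
     transcendental_over K x \<and>
     y ^ (2 * q0 ^ 2) + y = x ^ q0 * (x ^ (2 * q0 ^ 2) + x) \<and>
     (\<forall>S. is_subfield S \<and> K \<subseteq> S \<and> x \<in> S \<and> y \<in> S \<longrightarrow> S = UNIV)"

text \<open>
  Closed points of the smooth projective model are identified with the places of the
  function field, given by their normalized discrete valuations trivial on \<open>K\<close>.
  The value at \<open>0\<close> (mathematically \<open>\<infinity>\<close>) is irrelevant and pinned to \<open>0\<close>, so that
  distinct functions are distinct places.
\<close>

definition places :: "'f::field set \<Rightarrow> ('f \<Rightarrow> int) set" where
  "places K = {v. v 0 = 0 \<and>
     (\<forall>a b. a \<noteq> 0 \<longrightarrow> b \<noteq> 0 \<longrightarrow> v (a * b) = v a + v b) \<and>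
     (\<forall>a b. a \<noteq> 0 \<longrightarrow> b \<noteq> 0 \<longrightarrow> a + b \<noteq> 0 \<longrightarrow> min (v a) (v b) \<le> v (a + b)) \<and>
     (\<exists>t. t \<noteq> 0 \<and> v t = 1) \<and>
     (\<forall>c\<in>K. c \<noteq> 0 \<longrightarrow> v c = 0)}"

text \<open>Rational points: the residue field is \<open>K\<close>.\<close>

definition rational_places :: "'f::field set \<Rightarrow> ('f \<Rightarrow> int) set" where
  "rational_places K =
     {v \<in> places K. \<forall>f. 0 \<le> v f \<longrightarrow> (\<exists>c\<in>K. f = c \<or> 0 < v (f - c))}"

type_synonym 'f divisor = "('f \<Rightarrow> int) \<Rightarrow>\<^sub>0 int"

definition divisors :: "'f::field set \<Rightarrow> 'f divisor set" where
  "divisors K = {D. Poly_Mapping.keys D \<subseteq> places K}"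

definition principal_divisors :: "'f::field set \<Rightarrow> 'f divisor set" where
  "principal_divisors K =
     {D \<in> divisors K. \<exists>f. f \<noteq> 0 \<and> (\<forall>v\<in>places K. Poly_Mapping.lookup D v = v f)}"

definition lin_equiv :: "'f::field set \<Rightarrow> ('f divisor \<times> 'f divisor) set" where
  "lin_equiv K =
     {(A, B). A \<in> divisors K \<and> B \<in> divisors K \<and> A - B \<in> principal_divisors K}"

definition divisor_class :: "'f::field set \<Rightarrow> 'f divisor \<Rightarrow> 'f divisor set" where
  "divisor_class K A = lin_equiv K `` {A}"

definition riemann_roch_space :: "'f::field set \<Rightarrow> 'f divisor \<Rightarrow> 'f set" where
  "riemann_roch_space K E =
     {f. f \<noteq> 0 \<and> (\<forall>v\<in>places K. 0 \<le> v f + Poly_Mapping.lookup E v)} \<union> {0}"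

text \<open>The condition on \<open>A\<close> depends only on its divisor class.\<close>

definition discrepancies ::
    "'f::field set \<Rightarrow> ('f \<Rightarrow> int) \<Rightarrow> ('f \<Rightarrow> int) \<Rightarrow> 'f divisor set set" where
  "discrepancies K P Q = {divisor_class K A | A. A \<in> divisors K \<and>
     riemann_roch_space K A \<noteq> riemann_roch_space K (A - frag_of P) \<and>
     riemann_roch_space K (A - frag_of Q) = riemann_roch_space K (A - frag_of Q - frag_of P)}"

definition two_point_discrepancies ::
    "'f::field set \<Rightarrow> ('f \<Rightarrow> int) \<Rightarrow> ('f \<Rightarrow> int) \<Rightarrow> 'f divisor set set" where
  "two_point_discrepancies K P Q = discrepancies K P Q \<inter>
     {divisor_class K (frag_cmul i (frag_of P) + frag_cmul j (frag_of Q)) | i j. True}"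

end

theory Submission
  imports Defs
begin

text \<open>
  For fixed \<open>j\<close> at most one \<open>i P + j Q\<close> is a discrepancy: cancelling leading terms at \<open>Q\<close> of two
  witnesses would violate the second condition for one of them. Since \<open>m P \<sim> m Q\<close>, it therefore
  suffices that the \<open>m\<close> listed divisors are discrepancies and that their \<open>Q\<close>-coordinates form a
  complete residue system modulo \<open>m\<close>; inequivalence follows because the only listed divisor of
  degree \<open>0\<close> is \<open>0\<close>.

  Translations and an involution of the curve move \<open>P\<close> to infinity and \<open>Q\<close> to the origin. With
  \<open>z = x^(2 q0 + 1) + y^(2 q0)\<close> and \<open>w = x y^(2 q0) + z^(2 q0)\<close>, the functions \<open>x\<close>, \<open>y\<close>, \<open>z\<close> witness the
  first condition for \<open>E0\<close>, \<open>E1\<close>, \<open>E2\<close>, and \<open>w\<close> has divisor \<open>m (Q - P)\<close>. The list is stable under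
  \<open>A \<mapsto> K + P + Q - A\<close>, so the second condition reduces to \<open>2 g - 1\<close> being a gap at infinity. This gap
  is read off from the \<open>K[x]\<close>-basis \<open>y^i z^j w^k\<close> (\<open>i < 2\<close>, \<open>j, k < q0\<close>) of \<open>K[x, y]\<close>, whose
  pole orders are distinct modulo \<open>q\<close>, once every function regular away from infinity is known to
  lie in \<open>K[x, y]\<close>; for the latter, every prime of \<open>K[x, y]\<close> over a prime \<open>p\<close> of \<open>K[x]\<close> has a
  discrete valuation with uniformizer \<open>p\<close>, as Frobenius acts with finite order modulo \<open>p\<close>.
\<close>

section \<open>Valuations\<close>

text \<open>Neither Riemann-Roch nor the degree formula for principal divisors enters. The genus g =
  q0 (q - 1) is felt only through the single gap 2g - 1, and the relation between the orders at
  \<open>P\<close> and \<open>Q\<close> of a function supported there is itself drawn from the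
  uniqueness of discrepancies. A place is given only as an abstract valuation, so before coordinates
  can be used every place must be compared with the curve. At infinity this works because each
  function is a quotient of sums whose terms have distinct orders, which fixes its value. At affine
  places it works because \<open>K[x, y]\<close> contains every function that is regular there; this
  is where smoothness of the affine curve enters. The number \<open>m\<close> has two faces. It is
  the pole order of \<open>w\<close>, and it is the norm of the Gaussian integer q0 + (q0 + 1) i.
  The multiples of that integer form a lattice of index \<open>m\<close>, and the diamond |a| + |b|
  \<le> q0 meets each of its cosets exactly once. This makes E(a,b) the natural parametrization and
  explains why the \<open>Q\<close>-coordinates form a complete residue system.\<close>

context
  fixes K :: "'f::field set" and v :: "'f \<Rightarrow> int"
  assumes v: "v \<in> places K"
begin

lemma place_zero: "v 0 = 0"
  using v by (simp add: places_def)

lemma place_mult: "a \<noteq> 0 \<Longrightarrow> b \<noteq> 0 \<Longrightarrow> v (a * b) = v a + v b"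
  using v by (simp add: places_def)

lemma place_add: "a \<noteq> 0 \<Longrightarrow> b \<noteq> 0 \<Longrightarrow> a + b \<noteq> 0 \<Longrightarrow> min (v a) (v b) \<le> v (a + b)"
  using v by (simp add: places_def)

lemma place_const: "c \<in> K \<Longrightarrow> v c = 0"
  using v by (cases "c = 0") (auto simp: places_def)

lemma place_one: "v 1 = 0"
  using place_mult[of 1 1] by simp

lemma place_power: "v (a ^ n) = int n * v a"
proof (cases "a = 0")
  case True
  then show ?thesis by (cases n) (auto simp: place_zero place_one)
next
  case False
  then show ?thesis by (induction n) (auto simp: place_one place_mult algebra_simps)
qed

lemma place_uminus: "v (- a) = v a"
proof (cases "a = 0")
  case False
  have "v ((-1) * (-1)) = v (-1) + v (-1)"
    by (rule place_mult) auto
  hence "v (-1) = 0" by (simp add: place_one)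
  thus ?thesis using place_mult[of "-1" a] False by simp
qed simp

lemma place_inverse: "v (inverse a) = - v a"
proof (cases "a = 0")
  case False
  thus ?thesis using place_mult[of a "inverse a"] by (simp add: place_one)
qed (simp add: place_zero)

lemma place_divide: "a \<noteq> 0 \<Longrightarrow> b \<noteq> 0 \<Longrightarrow> v (a / b) = v a - v b"
  using place_mult[of a "inverse b"] by (simp add: divide_inverse place_inverse)

lemma place_add_less:
  assumes "a \<noteq> 0" "v a < v b"
  shows "a + b \<noteq> 0 \<and> v (a + b) = v a"
proof (cases "b = 0")
  case False
  have nz: "a + b \<noteq> 0"
  proof
    assume "a + b = 0"
    hence "b = - a" by (simp add: eq_neg_iff_add_eq_0 add.commute)
    thus False using assms by (simp add: place_uminus)
  qed
  have 1: "v a \<le> v (a + b)" using place_add[OF assms(1) False nz] assms(2) by simp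
  have "min (v (a + b)) (v (- b)) \<le> v ((a + b) + (- b))"
    using nz False assms by (intro place_add) auto
  hence "v (a + b) \<le> v a" using assms(2) by (simp add: place_uminus)
  thus ?thesis using 1 nz by simp
qed (use assms in simp)

lemma place_nonneg_mult: "0 \<le> v a \<Longrightarrow> 0 \<le> v b \<Longrightarrow> 0 \<le> v (a * b)"
  by (cases "a = 0 \<or> b = 0") (auto simp: place_zero place_mult)

lemma place_nonneg_add: "0 \<le> v a \<Longrightarrow> 0 \<le> v b \<Longrightarrow> 0 \<le> v (a + b)"
  using place_add[of a b]
  by (cases "a = 0 \<or> b = 0 \<or> a + b = 0") (auto simp: place_zero)

text \<open>\<open>v 0\<close> is pinned to 0 instead of infinity, so a vanishing sum or summand
  needs its own alternative in every bound.\<close>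

lemma place_sum_greater:
  assumes "finite J" "\<And>j. j \<in> J \<Longrightarrow> f j = 0 \<or> n < v (f j)"
  shows "sum f J = 0 \<or> n < v (sum f J)"
  using assms
proof (induction J rule: finite_induct)
  case (insert j J)
  hence IH: "sum f J = 0 \<or> n < v (sum f J)" and j: "f j = 0 \<or> n < v (f j)" by auto
  show ?case
  proof (cases "f j = 0 \<or> sum f J = 0 \<or> f j + sum f J = 0")
    case True
    thus ?thesis using insert.hyps IH j by auto
  next
    case False
    thus ?thesis using place_add[of "f j" "sum f J"] insert.hyps IH j by auto
  qed
qed simp

lemma place_sum_dominant:
  assumes "finite J" "j0 \<in> J" "f j0 \<noteq> 0"
    and "\<And>j. j \<in> J \<Longrightarrow> j \<noteq> j0 \<Longrightarrow> f j = 0 \<or> v (f j0) < v (f j)"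
  shows "sum f J \<noteq> 0 \<and> v (sum f J) = v (f j0)"
proof -
  have "sum f J = f j0 + sum f (J - {j0})"
    using assms by (simp add: sum.remove)
  moreover have "sum f (J - {j0}) = 0 \<or> v (f j0) < v (sum f (J - {j0}))"
    using assms by (intro place_sum_greater) auto
  ultimately show ?thesis using place_add_less[OF assms(3)] assms(3) by auto
qed

end

section \<open>Polynomials over a subfield\<close>

definition polys_over :: "'f::field set \<Rightarrow> 'f poly set" where
  "polys_over K = {g. \<forall>i. poly.coeff g i \<in> K}"

lemma polys_over_coeff: "g \<in> polys_over K \<Longrightarrow> poly.coeff g i \<in> K"
  by (simp add: polys_over_def)

text \<open>At a pole of \<open>t\<close> the terms of higher degree have strictly smaller value, so
  the leading term dominates. In particular a function with a pole is transcendental over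
  \<open>K\<close>.\<close>

lemma place_poly:
  assumes v: "v \<in> places K" and t: "v t < 0" and g: "g \<in> polys_over K" "g \<noteq> 0"
  shows "poly g t \<noteq> 0 \<and> v (poly g t) = int (degree g) * v t"
proof -
  have t0: "t \<noteq> 0" using t place_zero[OF v] by auto
  have val: "v (poly.coeff g i * t ^ i) = int i * v t" if "poly.coeff g i \<noteq> 0" for i
    using that t0 place_const[OF v polys_over_coeff[OF g(1)]]
    by (simp add: place_mult[OF v] place_power[OF v])
  have lc: "poly.coeff g (degree g) \<noteq> 0" using g by simp
  have "sum (\<lambda>i. poly.coeff g i * t ^ i) {..degree g} \<noteq> 0 \<and>
        v (sum (\<lambda>i. poly.coeff g i * t ^ i) {..degree g}) =
        v (poly.coeff g (degree g) * t ^ degree g)"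
  proof (rule place_sum_dominant[OF v])
    fix j assume "j \<in> {..degree g}" "j \<noteq> degree g"
    hence "int (degree g) * v t < int j * v t" using t by simp
    thus "poly.coeff g j * t ^ j = 0 \<or>
        v (poly.coeff g (degree g) * t ^ degree g) < v (poly.coeff g j * t ^ j)"
      using val[of j] val[OF lc] by auto
  qed (use t0 lc in auto)
  thus ?thesis using val[OF lc] by (simp add: poly_altdef)
qed

locale subfield =
  fixes K :: "'f::field set"
  assumes subfield: "is_subfield K"
begin

lemma zero_closed [simp, intro]: "0 \<in> K"
  and one_closed [simp, intro]: "1 \<in> K"
  and add_closed: "a \<in> K \<Longrightarrow> b \<in> K \<Longrightarrow> a + b \<in> K"
  and mult_closed: "a \<in> K \<Longrightarrow> b \<in> K \<Longrightarrow> a * b \<in> K"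
  and uminus_closed: "a \<in> K \<Longrightarrow> - a \<in> K"
  and inverse_closed: "a \<in> K \<Longrightarrow> inverse a \<in> K"
  using subfield by (auto simp: is_subfield_def)

lemma divide_closed: "a \<in> K \<Longrightarrow> b \<in> K \<Longrightarrow> a / b \<in> K"
  by (simp add: divide_inverse mult_closed inverse_closed)

lemma power_closed: "a \<in> K \<Longrightarrow> a ^ n \<in> K"
  by (induction n) (auto intro: mult_closed)

lemma sum_closed: "(\<And>i. i \<in> J \<Longrightarrow> f i \<in> K) \<Longrightarrow> sum f J \<in> K"
  by (induction J rule: infinite_finite_induct) (auto intro: add_closed)

lemma polys_zero [simp]: "0 \<in> polys_over K"
  and polys_one [simp]: "1 \<in> polys_over K"
  and polys_monom: "c \<in> K \<Longrightarrow> monom c n \<in> polys_over K"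
  and polys_const: "c \<in> K \<Longrightarrow> [:c:] \<in> polys_over K"
  and polys_add: "g \<in> polys_over K \<Longrightarrow> h \<in> polys_over K \<Longrightarrow> g + h \<in> polys_over K"
  and polys_uminus: "g \<in> polys_over K \<Longrightarrow> - g \<in> polys_over K"
  and polys_mult: "g \<in> polys_over K \<Longrightarrow> h \<in> polys_over K \<Longrightarrow> g * h \<in> polys_over K"
  by (auto simp: polys_over_def coeff_mult coeff_pCons split: nat.splits
      intro: add_closed uminus_closed sum_closed mult_closed)

lemma polys_diff: "g \<in> polys_over K \<Longrightarrow> h \<in> polys_over K \<Longrightarrow> g - h \<in> polys_over K"
  using polys_add[of g "- h"] polys_uminus by simp

lemma polys_division:
  assumes h: "h \<in> polys_over K" "h \<noteq> 0" and g: "g \<in> polys_over K"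
  shows "\<exists>s\<in>polys_over K. \<exists>r\<in>polys_over K. g = s * h + r \<and> (r = 0 \<or> degree r < degree h)"
  using g
proof (induction "degree g" arbitrary: g rule: less_induct)
  case less
  show ?case
  proof (cases "g = 0 \<or> degree g < degree h")
    case True
    thus ?thesis using less.prems by (intro bexI[of _ 0] bexI[of _ g]) auto
  next
    case False
    define c where "c = monom (lead_coeff g / lead_coeff h) (degree g - degree h)"
    have c: "c \<in> polys_over K" unfolding c_def
      using h less.prems by (intro polys_monom divide_closed polys_over_coeff)
    define g' where "g' = g - c * h"
    have g': "g' \<in> polys_over K" unfolding g'_def
      using h c less.prems by (intro polys_diff polys_mult)
    have dc: "degree (c * h) \<le> degree g"
      using False degree_mult_le[of c h] degree_monom_le[of "lead_coeff g / lead_coeff h" "degree g - degree h"]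
      unfolding c_def by linarith
    have cf: "poly.coeff g' (degree g) = 0"
      using False h unfolding g'_def c_def by (simp add: coeff_monom_mult)
    have dle: "degree g' \<le> degree g" unfolding g'_def using dc by (intro degree_diff_le) auto
    have "g' = 0 \<or> degree g' < degree g"
      using cf dle by (metis le_neq_implies_less leading_coeff_0_iff)
    then obtain s r where "s \<in> polys_over K" "r \<in> polys_over K"
      "g' = s * h + r" "r = 0 \<or> degree r < degree h"
    proof
      assume "g' = 0" thus ?thesis by (intro that[of 0 0]) auto
    next
      assume "degree g' < degree g" thus ?thesis using less.hyps[of g'] g' that by blast
    qed
    thus ?thesis using c unfolding g'_def
      by (intro bexI[of _ "s + c"] bexI[of _ r]) (auto simp: algebra_simps intro: polys_add)
  qed
qed

lemma finite_polys_degree: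
  assumes "finite K"
  shows "finite {g \<in> polys_over K. degree g < n}"
proof (rule finite_subset)
  show "finite (Poly ` {xs. set xs \<subseteq> K \<and> length xs \<le> n})"
    using assms by (intro finite_imageI finite_lists_length_le)
  show "{g \<in> polys_over K. degree g < n} \<subseteq> Poly ` {xs. set xs \<subseteq> K \<and> length xs \<le> n}"
  proof
    fix g assume g: "g \<in> {g \<in> polys_over K. degree g < n}"
    have "set (coeffs g) \<subseteq> K" using g by (auto simp: coeffs_def polys_over_def)
    moreover have "length (coeffs g) \<le> n" using g by (cases "g = 0") (auto simp: length_coeffs)
    ultimately show "g \<in> Poly ` {xs. set xs \<subseteq> K \<and> length xs \<le> n}"
      by (intro image_eqI[of _ _ "coeffs g"]) auto
  qed
qed

text \<open>Translation by 1 permutes \<open>K\<close>, so comparing the two sums over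
  \<open>K\<close> leaves \<open>card K\<close> copies of 1 equal to 0. This is the source of
  characteristic 2.\<close>

lemma of_nat_card: "of_nat (card K) = (0::'f)"
proof (cases "finite K")
  case True
  have "bij_betw (\<lambda>a. a + 1) K K"
    using add_closed[OF _ one_closed] add_closed[OF _ uminus_closed[OF one_closed]]
    by (intro bij_betw_byWitness[of _ "\<lambda>a. a + (- 1)"] ballI subsetI)
       (auto simp del: add_uminus_conv_diff simp: add.assoc)
  hence "(\<Sum>a\<in>K. a + 1) = \<Sum>K"
    by (rule sum.reindex_bij_betw)
  thus ?thesis by (simp add: sum.distrib)
qed simp

lemma power_card:
  assumes fin: "finite K" and a: "a \<in> K"
  shows "a ^ card K = a"
proof (cases "a = 0")
  case True
  have "card K > 0" using fin by (auto simp: card_gt_0_iff)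
  thus ?thesis using True by simp
next
  case False
  have "bij_betw (\<lambda>b. a * b) (K - {0}) (K - {0})"
    using mult_closed[OF a] mult_closed[OF inverse_closed[OF a]] False
    by (intro bij_betw_byWitness[of _ "\<lambda>b. inverse a * b"] ballI subsetI)
       (auto simp: mult.assoc[symmetric])
  hence "(\<Prod>b\<in>K-{0}. a * b) = \<Prod>(K - {0})"
    by (rule prod.reindex_bij_betw)
  moreover have "\<Prod>(K - {0}) \<noteq> 0" using fin by simp
  ultimately have "a ^ card (K - {0}) = 1" by (simp add: prod.distrib)
  moreover have "card K = Suc (card (K - {0}))" by (rule card.remove[OF fin zero_closed])
  ultimately show ?thesis by (simp only: power_Suc mult.right_neutral)
qed

end

lemma frobenius_char_2:
  fixes a b :: "'a::comm_ring_1"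
  assumes "(1::'a) + 1 = 0"
  shows "(a + b) ^ (2 ^ n) = a ^ (2 ^ n) + b ^ (2 ^ n)"
proof (induction n)
  case (Suc n)
  have two: "c + c = 0" for c :: 'a using arg_cong[OF assms, of "\<lambda>t. c * t"] by (simp add: algebra_simps)
  have "(a + b) ^ (2 ^ Suc n) = ((a + b) ^ (2 ^ n)) ^ 2" by (simp flip: power_mult add: mult.commute)
  also have "\<dots> = (a ^ (2 ^ n)) ^ 2 + (b ^ (2 ^ n)) ^ 2"
    unfolding Suc.IH using two[of "a ^ (2 ^ n) * b ^ (2 ^ n)"]
    by (simp only: power2_sum mult_2 mult.assoc add.right_neutral distrib_right)
  also have "\<dots> = a ^ (2 ^ Suc n) + b ^ (2 ^ Suc n)" by (simp flip: power_mult add: mult.commute)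
  finally show ?case .
qed simp

section \<open>Homogeneous linear systems over a subring\<close>

text \<open>Gaussian elimination with cross-multiplication instead of division, so that the solution
  stays in the subring \<open>A\<close>; it is applied with \<open>A\<close> equal to
  \<open>K[x]\<close>.\<close>

lemma homogeneous_system_solution:
  fixes A :: "'a::idom set" and M :: "'i \<Rightarrow> 'j \<Rightarrow> 'a"
  assumes A0: "0 \<in> A" and A1: "1 \<in> A"
    and Add: "\<And>a b. a \<in> A \<Longrightarrow> b \<in> A \<Longrightarrow> a + b \<in> A"
    and Neg: "\<And>a. a \<in> A \<Longrightarrow> - a \<in> A"
    and Mult: "\<And>a b. a \<in> A \<Longrightarrow> b \<in> A \<Longrightarrow> a * b \<in> A"
    and "finite I" "finite J" "card I < card J"
    and "\<And>i j. i \<in> I \<Longrightarrow> j \<in> J \<Longrightarrow> M i j \<in> A"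
  shows "\<exists>c. (\<forall>j\<in>J. c j \<in> A) \<and> (\<exists>j\<in>J. c j \<noteq> 0) \<and> (\<forall>i\<in>I. (\<Sum>j\<in>J. c j * M i j) = 0)"
  using assms(6-)
proof (induction I arbitrary: J M rule: finite_induct)
  case empty
  hence "J \<noteq> {}" by auto
  thus ?case using A1 by (intro exI[of _ "\<lambda>_. 1"]) auto
next
  case (insert r I)
  show ?case
  proof (cases "\<forall>j\<in>J. M r j = 0")
    case True
    have "\<exists>c. (\<forall>j\<in>J. c j \<in> A) \<and> (\<exists>j\<in>J. c j \<noteq> 0) \<and> (\<forall>i\<in>I. (\<Sum>j\<in>J. c j * M i j) = 0)"
      using insert.prems insert.hyps by (intro insert.IH) auto
    thus ?thesis using True by auto
  next
    case False
    then obtain j0 where j0: "j0 \<in> J" "M r j0 \<noteq> 0" by blast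
    define J' where "J' = J - {j0}"
    define M' where "M' = (\<lambda>i j. M r j0 * M i j + - (M i j0 * M r j))"
    have sumA: "sum f X \<in> A" if "\<And>j. j \<in> X \<Longrightarrow> f j \<in> A" for f :: "'j \<Rightarrow> 'a" and X
      using that by (induction X rule: infinite_finite_induct) (auto intro: A0 Add)
    have "\<exists>c. (\<forall>j\<in>J'. c j \<in> A) \<and> (\<exists>j\<in>J'. c j \<noteq> 0) \<and> (\<forall>i\<in>I. (\<Sum>j\<in>J'. c j * M' i j) = 0)"
    proof (rule insert.IH)
      show "card I < card J'" using insert.prems insert.hyps j0 by (simp add: J'_def)
      show "M' i j \<in> A" if "i \<in> I" "j \<in> J'" for i j
        using that insert.prems j0 unfolding M'_def J'_def by (intro Add Neg Mult) auto
    qed (use insert.prems in \<open>auto simp: J'_def\<close>)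
    then obtain c where c: "\<forall>j\<in>J'. c j \<in> A" "\<exists>j\<in>J'. c j \<noteq> 0"
      "\<forall>i\<in>I. (\<Sum>j\<in>J'. c j * M' i j) = 0" by blast
    \<comment> \<open>Scaling the other unknowns by the pivot \<open>M r j0\<close> lets the pivot
      unknown be solved for without a division.\<close>
    define d where "d = (\<lambda>j. if j = j0 then - (\<Sum>j\<in>J'. c j * M r j) else M r j0 * c j)"
    have split: "(\<Sum>j\<in>J. d j * M i j) = (\<Sum>j\<in>J'. c j * M' i j)" for i
    proof -
      have "(\<Sum>j\<in>J. d j * M i j) = d j0 * M i j0 + (\<Sum>j\<in>J'. d j * M i j)"
        unfolding J'_def using insert.prems j0 by (simp add: sum.remove)
      also have "(\<Sum>j\<in>J'. d j * M i j) = (\<Sum>j\<in>J'. M r j0 * c j * M i j)"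
        by (intro sum.cong) (auto simp: d_def J'_def)
      also have "d j0 * M i j0 + \<dots> = (\<Sum>j\<in>J'. c j * M' i j)"
        by (simp add: d_def M'_def sum_subtractf algebra_simps sum_distrib_left sum_distrib_right)
      finally show ?thesis .
    qed
    have r0: "(\<Sum>j\<in>J'. c j * M' r j) = 0"
      by (simp add: M'_def mult.commute)
    have "\<forall>j\<in>J. d j \<in> A"
      using c(1) insert.prems j0 unfolding d_def J'_def by (auto intro!: Neg Mult sumA)
    moreover have "\<exists>j\<in>J. d j \<noteq> 0"
    proof -
      obtain j where "j \<in> J'" "c j \<noteq> 0" using c(2) by blast
      thus ?thesis using j0 by (intro bexI[of _ j]) (auto simp: d_def J'_def)
    qed
    ultimately show ?thesis using split r0 c(3) by (intro exI[of _ d]) auto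
  qed
qed

section \<open>The coordinate ring of the Suzuki curve\<close>

lemma int_mult_cancel: "c \<noteq> 0 \<Longrightarrow> c * a = c * b \<Longrightarrow> a = (b::int)"
  by simp

locale suzuki = subfield K for K :: "'f::field set" +
  fixes q0 :: nat and x y :: 'f
  assumes q0_power: "\<exists>s::nat. q0 = 2 ^ s"
    and card_K: "card K = 2 * q0 ^ 2"
    and transcendental_x: "transcendental_over K x"
    and curve: "y ^ (2 * q0 ^ 2) + y = x ^ q0 * (x ^ (2 * q0 ^ 2) + x)"
    and generated: "\<And>S. is_subfield S \<Longrightarrow> K \<subseteq> S \<Longrightarrow> x \<in> S \<Longrightarrow> y \<in> S \<Longrightarrow> S = UNIV"

lemma suzuki_iff:
  "suzuki K q0 x y \<longleftrightarrow> (\<exists>s::nat. q0 = 2 ^ s) \<and> suzuki_function_field q0 K x y"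
  unfolding suzuki_def suzuki_axioms_def subfield_def suzuki_function_field_def by blast

context suzuki
begin

abbreviation q :: nat where "q \<equiv> 2 * q0 ^ 2"
abbreviation m :: nat where "m \<equiv> 2 * q0 ^ 2 + 2 * q0 + 1"

text \<open>\<open>z\<close> and \<open>w\<close> are the classical further functions on the curve:
  the pole orders \<open>q\<close>, \<open>q + q0\<close>, \<open>q + 2 * q0\<close> and
  \<open>m\<close> of \<open>x\<close>, \<open>y\<close>, \<open>z\<close>, \<open>w\<close>
  generate the Weierstrass semigroup at infinity.\<close>

definition z :: 'f where "z = x ^ (2 * q0 + 1) + y ^ (2 * q0)"
definition w :: 'f where "w = x * y ^ (2 * q0) + z ^ (2 * q0)"

lemma q0_pos: "q0 > 0" using q0_power by auto

lemma q_nonzero: "int q \<noteq> 0" using q0_pos by simp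

lemma one_le_q0_square: "1 \<le> q0 ^ 2"
  using q0_pos by simp

lemma finite_K: "finite K"
  using card_K q0_pos by (intro card_ge_0_finite) simp

lemma one_plus_one: "(1::'f) + 1 = 0"
proof -
  obtain s where "q0 = 2 ^ s" using q0_power by blast
  hence "(2::'f) ^ (2 * s + 1) = 0"
    using of_nat_card by (simp add: card_K power_mult power_commutes mult.commute)
  thus ?thesis by auto
qed

lemma two_cancel [simp]: "(a::'f) + a = 0" "a + (a + b) = b"
proof -
  show *: "a + a = 0" for a :: 'f
    using arg_cong[OF one_plus_one, of "\<lambda>t. a * t"] by (simp add: algebra_simps)
  show "a + (a + b) = b" by (simp add: * flip: add.assoc)
qed

lemma minus_eq: "- (a::'f) = a"
  by (metis add_eq_0_iff two_cancel(1))

lemma diff_eq: "(a::'f) - b = a + b"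
  using minus_eq[of b] by (metis add_uminus_conv_diff)

lemma sum_zeroD: "(a::'f) + b = 0 \<Longrightarrow> a = b"
  by (simp flip: diff_eq)

lemma frob_q0: "((a::'f) + b) ^ q0 = a ^ q0 + b ^ q0"
  using q0_power frobenius_char_2[OF one_plus_one] by auto

lemma frob_2q0: "((a::'f) + b) ^ (2 * q0) = a ^ (2 * q0) + b ^ (2 * q0)"
proof -
  obtain s where "q0 = 2 ^ s" using q0_power by blast
  hence "2 * q0 = 2 ^ Suc s" by simp
  thus ?thesis using frobenius_char_2[OF one_plus_one] by metis
qed

lemma frob_q: "((a::'f) + b) ^ q = a ^ q + b ^ q"
proof -
  have "c ^ q = (c ^ q0) ^ (2 * q0)" for c :: 'f
    by (simp flip: power_mult add: power2_eq_square mult.left_commute)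
  thus ?thesis by (simp only: frob_q0 frob_2q0)
qed

lemma frob_q_power: "((a::'f) + b) ^ (q ^ n) = a ^ (q ^ n) + b ^ (q ^ n)"
proof (induction n)
  case (Suc n)
  have "c ^ (q ^ Suc n) = (c ^ (q ^ n)) ^ q" for c :: 'f
    by (simp only: power_Suc flip: power_mult) (simp only: mult.commute)
  thus ?case by (simp only: Suc.IH frob_q)
qed simp

lemma const_power_q: "c \<in> K \<Longrightarrow> c ^ q = c"
  using power_card[OF finite_K] by (simp add: card_K)

section \<open>Relations among \<open>x\<close>, \<open>y\<close>, \<open>z\<close> and
  \<open>w\<close>\<close>

lemma y_power_q: "y ^ q = y + x ^ q0 * x ^ q + x ^ q0 * x"
proof -
  have "y ^ q = (y ^ q + y) + y" by (simp add: ac_simps)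
  thus ?thesis unfolding curve by (simp add: algebra_simps)
qed

text \<open>Raising to the power \<open>q0\<close> turns \<open>y ^ (2 * q0)\<close> into
  \<open>y ^ q\<close>, which the curve equation lowers; the same device gives
  \<open>w_power_q0\<close>.\<close>

lemma z_power_q0: "z ^ q0 = y + x ^ (q0 + 1)"
proof -
  have "z ^ q0 = x ^ ((2 * q0 + 1) * q0) + y ^ (2 * q0 * q0)"
    unfolding z_def frob_q0 by (simp only: power_mult)
  also have "\<dots> = x ^ q0 * x ^ q + y ^ q"
    by (simp add: algebra_simps power2_eq_square flip: power_add)
  finally show ?thesis unfolding y_power_q by (simp add: algebra_simps)
qed

lemma x_power_2q0: "x ^ (2 * q0) = x ^ q0 * x ^ q0" "x ^ (2 * q0 + 1) = x ^ q0 * x ^ q0 * x"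
  by (simp_all add: mult_2 power_add)

lemma w_power_q0: "w ^ q0 = x ^ q0 * y + z"
proof -
  have "w ^ q0 = x ^ q0 * y ^ (2 * q0 * q0) + (z ^ q0) ^ (2 * q0)"
    unfolding w_def frob_q0 power_mult_distrib by (simp only: power_mult[symmetric] mult.commute)
  also have "(z ^ q0) ^ (2 * q0) = y ^ (2 * q0) + x ^ q * x ^ (2 * q0)"
    unfolding z_power_q0 frob_2q0
    by (simp flip: power_add power_mult add: algebra_simps power2_eq_square)
  also have "y ^ (2 * q0 * q0) = y ^ q" by (simp add: power2_eq_square mult.assoc)
  finally show ?thesis unfolding y_power_q z_def x_power_2q0
    by (simp add: algebra_simps)
qed

text \<open>The \<open>q0\<close>-th powers of both sides agree by the two preceding relations, and
  the \<open>q0\<close>-th power map is additive with trivial kernel.\<close>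

lemma y_square: "y ^ 2 = x * z + w"
proof -
  have "(y ^ 2 + (x * z + w)) ^ q0 = (y ^ 2) ^ q0 + (x ^ q0 * z ^ q0 + w ^ q0)"
    by (simp only: frob_q0 power_mult_distrib)
  also have "\<dots> = 0"
    unfolding z_power_q0 w_power_q0 unfolding z_def x_power_2q0
    by (simp add: algebra_simps flip: power_mult)
  finally have "y ^ 2 + (x * z + w) = 0" using q0_pos by simp
  thus ?thesis by (rule sum_zeroD)
qed

section \<open>The rings \<open>K[x]\<close> and \<open>K[x, y]\<close>\<close>

definition poly_ring :: "'f set" where "poly_ring = (\<lambda>g. poly g x) ` polys_over K"

inductive_set coord_ring :: "'f set" where
  const: "c \<in> K \<Longrightarrow> c \<in> coord_ring"
| x: "x \<in> coord_ring"
| y: "y \<in> coord_ring"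
| add: "a \<in> coord_ring \<Longrightarrow> b \<in> coord_ring \<Longrightarrow> a + b \<in> coord_ring"
| mult: "a \<in> coord_ring \<Longrightarrow> b \<in> coord_ring \<Longrightarrow> a * b \<in> coord_ring"

lemma poly_ringI: "g \<in> polys_over K \<Longrightarrow> poly g x \<in> poly_ring"
  by (simp add: poly_ring_def)

lemma poly_ring_const: "c \<in> K \<Longrightarrow> c \<in> poly_ring"
  using poly_ringI[OF polys_const[of c]] by simp

lemma poly_ring_x: "x \<in> poly_ring"
  using poly_ringI[OF polys_monom[of 1 1]] by (simp add: poly_monom)

lemma poly_ring_add: "a \<in> poly_ring \<Longrightarrow> b \<in> poly_ring \<Longrightarrow> a + b \<in> poly_ring"
  unfolding poly_ring_def using polys_add by (force simp flip: poly_add)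

lemma poly_ring_mult: "a \<in> poly_ring \<Longrightarrow> b \<in> poly_ring \<Longrightarrow> a * b \<in> poly_ring"
  unfolding poly_ring_def using polys_mult by (force simp flip: poly_mult)

lemma poly_ring_uminus: "a \<in> poly_ring \<Longrightarrow> - a \<in> poly_ring"
  by (simp add: minus_eq)

lemma poly_ring_power: "a \<in> poly_ring \<Longrightarrow> a ^ n \<in> poly_ring"
  by (induction n) (auto intro: poly_ring_mult poly_ring_const)

lemma poly_x_eq_0_iff: "g \<in> polys_over K \<Longrightarrow> poly g x = 0 \<longleftrightarrow> g = 0"
  using transcendental_x unfolding transcendental_over_def polys_over_def by auto

lemma coord_ring_power: "a \<in> coord_ring \<Longrightarrow> a ^ n \<in> coord_ring"
  by (induction n) (auto intro: coord_ring.intros)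

lemma coord_ring_sum: "(\<And>j. j \<in> J \<Longrightarrow> f j \<in> coord_ring) \<Longrightarrow> sum f J \<in> coord_ring"
  by (induction J rule: infinite_finite_induct) (auto intro: coord_ring.intros)

lemma poly_ring_subset:
  assumes "a \<in> poly_ring"
  shows "a \<in> coord_ring"
proof -
  obtain g where g: "g \<in> polys_over K" "a = poly g x" using assms by (auto simp: poly_ring_def)
  show ?thesis unfolding g(2) poly_altdef
    using coord_ring.const[OF polys_over_coeff[OF g(1)]]
    by (intro coord_ring_sum coord_ring.mult coord_ring_power coord_ring.x)
qed

lemma z_in_coord_ring: "z \<in> coord_ring" and w_in_coord_ring: "w \<in> coord_ring"
proof -
  show "z \<in> coord_ring" unfolding z_def by (intro coord_ring.add coord_ring.mult coord_ring_power coord_ring.x coord_ring.y)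
  thus "w \<in> coord_ring" unfolding w_def by (intro coord_ring.add coord_ring.mult coord_ring_power coord_ring.x coord_ring.y)
qed

text \<open>The pole orders of these \<open>q\<close> monomials are pairwise incongruent modulo \<open>q\<close>.\<close>

definition monomials :: "(nat \<times> nat \<times> nat) set" where
  "monomials = {..<2} \<times> {..<q0} \<times> {..<q0}"

definition mono_val :: "nat \<times> nat \<times> nat \<Rightarrow> 'f" where
  "mono_val = (\<lambda>(i, j, k). y ^ i * z ^ j * w ^ k)"

definition pole_order :: "nat \<times> nat \<times> nat \<Rightarrow> nat" where
  "pole_order = (\<lambda>(i, j, k). i * (q + q0) + j * (q + 2 * q0) + k * m)"

definition mono_span :: "'f set" where
  "mono_span = {(\<Sum>b\<in>monomials. poly (c b) x * mono_val b) | c. \<forall>b\<in>monomials. c b \<in> polys_over K}"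

section \<open>\<open>K[x, y]\<close> as a finitely generated \<open>K[x]\<close>-module\<close>

lemma finite_monomials: "finite monomials"
  by (simp add: monomials_def)

lemma mono_span_add: "a \<in> mono_span \<Longrightarrow> b \<in> mono_span \<Longrightarrow> a + b \<in> mono_span"
proof -
  assume "a \<in> mono_span" "b \<in> mono_span"
  then obtain c d where
    "a = (\<Sum>b\<in>monomials. poly (c b) x * mono_val b)" "\<forall>b\<in>monomials. c b \<in> polys_over K"
    "b = (\<Sum>b\<in>monomials. poly (d b) x * mono_val b)" "\<forall>b\<in>monomials. d b \<in> polys_over K"
    by (auto simp: mono_span_def)
  thus ?thesis unfolding mono_span_def
    by (intro CollectI exI[of _ "\<lambda>b. c b + d b"])
       (auto simp: sum.distrib[symmetric] algebra_simps intro: polys_add)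
qed

lemma mono_span_scale: "a \<in> poly_ring \<Longrightarrow> b \<in> mono_span \<Longrightarrow> a * b \<in> mono_span"
proof -
  assume "a \<in> poly_ring" "b \<in> mono_span"
  then obtain g d where "a = poly g x" "g \<in> polys_over K"
    "b = (\<Sum>b\<in>monomials. poly (d b) x * mono_val b)" "\<forall>b\<in>monomials. d b \<in> polys_over K"
    by (auto simp: mono_span_def poly_ring_def)
  thus ?thesis unfolding mono_span_def
    by (intro CollectI exI[of _ "\<lambda>b. g * d b"])
       (auto simp: sum_distrib_left algebra_simps intro: polys_mult)
qed

lemma mono_span_sum:
  "finite J \<Longrightarrow> (\<And>j. j \<in> J \<Longrightarrow> f j \<in> mono_span) \<Longrightarrow> sum f J \<in> mono_span"
proof (induction J rule: finite_induct)
  case empty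
  show ?case unfolding mono_span_def by (intro CollectI exI[of _ "\<lambda>_. 0"]) auto
qed (auto intro: mono_span_add)

lemma mono_span_monomial: "b \<in> monomials \<Longrightarrow> mono_val b \<in> mono_span"
  unfolding mono_span_def
proof (intro CollectI exI[of _ "\<lambda>b'. if b' = b then 1 else 0"] conjI)
  assume b: "b \<in> monomials"
  have "(\<Sum>b'\<in>monomials. poly (if b' = b then 1 else 0) x * mono_val b') =
        (\<Sum>b'\<in>monomials. if b' = b then mono_val b' else 0)" by (intro sum.cong) auto
  thus "mono_val b = (\<Sum>b'\<in>monomials. poly (if b' = b then 1 else 0) x * mono_val b')"
    using b finite_monomials by simp
qed auto

text \<open>The boundary case \<open>j = q0\<close> is included because replacing
  \<open>y ^ 2\<close> by \<open>x * z + w\<close> raises the exponent of \<open>z\<close> by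
  one.\<close>

lemma z_w_in_span:
  assumes "j \<le> q0" "k < q0"
  shows "z ^ j * w ^ k \<in> mono_span"
proof (cases "j = q0")
  case False
  thus ?thesis using assms mono_span_monomial[of "(0, j, k)"]
    by (simp add: monomials_def mono_val_def)
next
  case True
  have "mono_val (1, 0, k) + x ^ (q0 + 1) * mono_val (0, 0, k) \<in> mono_span"
    using assms q0_pos
    by (intro mono_span_add mono_span_scale mono_span_monomial poly_ring_power poly_ring_x)
       (auto simp: monomials_def)
  thus ?thesis unfolding True z_power_q0 by (simp add: mono_val_def algebra_simps)
qed

text \<open>An overflowing exponent of \<open>y\<close>, \<open>z\<close> or \<open>w\<close> is
  removed by \<open>y_square\<close>, \<open>z_power_q0\<close> or \<open>w_power_q0\<close>. The
  rewriting stops because the last rule resets the exponent of \<open>w\<close> to 0.\<close>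

lemma y_mult_monomial:
  assumes "b \<in> monomials"
  shows "y * mono_val b \<in> mono_span"
proof -
  obtain i j k where b: "b = (i, j, k)" "i < 2" "j < q0" "k < q0"
    using assms by (auto simp: monomials_def)
  show ?thesis
  proof (cases "i = 0")
    case True
    thus ?thesis using b mono_span_monomial[of "(1, j, k)"]
      by (simp add: monomials_def mono_val_def algebra_simps)
  next
    case False
    hence i: "i = 1" using b by simp
    have 1: "x * (z ^ Suc j * w ^ k) \<in> mono_span"
      using b by (intro mono_span_scale poly_ring_x z_w_in_span) auto
    have 2: "z ^ j * w ^ Suc k \<in> mono_span"
    proof (cases "Suc k = q0")
      case False
      thus ?thesis using b by (intro z_w_in_span) auto
    next
      case True
      have "x ^ q0 * mono_val (1, j, 0) + z ^ Suc j * w ^ 0 \<in> mono_span"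
        using b q0_pos
        by (intro mono_span_add mono_span_scale mono_span_monomial poly_ring_power poly_ring_x z_w_in_span)
           (auto simp: monomials_def)
      thus ?thesis unfolding True w_power_q0 by (simp add: mono_val_def algebra_simps)
    qed
    have "y * mono_val b = y ^ 2 * (z ^ j * w ^ k)"
      using b i by (simp add: mono_val_def power2_eq_square algebra_simps)
    also have "\<dots> = x * (z ^ Suc j * w ^ k) + z ^ j * w ^ Suc k"
      unfolding y_square by (simp add: algebra_simps)
    finally show ?thesis using mono_span_add[OF 1 2] by simp
  qed
qed

lemma coord_ring_mult_span: "a \<in> coord_ring \<Longrightarrow> b \<in> mono_span \<Longrightarrow> a * b \<in> mono_span"
proof (induction a arbitrary: b rule: coord_ring.induct)
  case y
  then obtain c where c: "b = (\<Sum>b\<in>monomials. poly (c b) x * mono_val b)"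
    "\<forall>b\<in>monomials. c b \<in> polys_over K" by (auto simp: mono_span_def)
  have "y * b = (\<Sum>b\<in>monomials. poly (c b) x * (y * mono_val b))"
    unfolding c(1) by (simp add: sum_distrib_left algebra_simps)
  also have "\<dots> \<in> mono_span"
    using c(2) finite_monomials
    by (intro mono_span_sum mono_span_scale poly_ringI y_mult_monomial) auto
  finally show ?case .
next
  case (add a a')
  thus ?case using mono_span_add by (simp add: distrib_right)
next
  case (mult a a')
  thus ?case by (simp add: mult.assoc)
qed (auto intro: mono_span_scale poly_ring_const poly_ring_x)

lemma coord_ring_in_span: "a \<in> coord_ring \<Longrightarrow> a \<in> mono_span"
  using coord_ring_mult_span[of a 1] mono_span_monomial[of "(0,0,0)"] q0_pos
  by (simp add: monomials_def mono_val_def)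

text \<open>The \<open>n + 1\<close> powers of \<open>a\<close> up to \<open>a ^ n\<close> lie in a
  \<open>K[x]\<close>-module with \<open>n\<close> generators, hence satisfy a nontrivial relation
  over \<open>K[x]\<close>. After division by the lowest power of \<open>a\<close> that occurs, its
  coefficient is seen to be a multiple of \<open>a\<close>.\<close>

lemma coord_ring_divides_poly:
  assumes a: "a \<in> coord_ring" "a \<noteq> 0"
  shows "\<exists>b\<in>coord_ring. a * b \<in> poly_ring \<and> a * b \<noteq> 0"
proof -
  define n where "n = card monomials"
  have "\<forall>j. \<exists>c. a ^ j = (\<Sum>b\<in>monomials. poly (c b) x * mono_val b) \<and> (\<forall>b\<in>monomials. c b \<in> polys_over K)"
    using coord_ring_in_span[OF coord_ring_power[OF a(1)]] by (auto simp: mono_span_def)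
  then obtain c where c: "\<And>j. a ^ j = (\<Sum>b\<in>monomials. poly (c j b) x * mono_val b)"
    "\<And>j b. b \<in> monomials \<Longrightarrow> c j b \<in> polys_over K" by metis
  have "\<exists>d. (\<forall>j\<in>{..n}. d j \<in> poly_ring) \<and> (\<exists>j\<in>{..n}. d j \<noteq> 0) \<and>
        (\<forall>b\<in>monomials. (\<Sum>j\<in>{..n}. d j * poly (c j b) x) = 0)"
    using c(2) finite_monomials
    by (intro homogeneous_system_solution)
       (auto intro: poly_ring_const poly_ring_add poly_ring_mult poly_ring_uminus poly_ringI simp: n_def)
  then obtain d where d: "\<forall>j\<in>{..n}. d j \<in> poly_ring" "\<exists>j. j \<le> n \<and> d j \<noteq> 0"
    "\<forall>b\<in>monomials. (\<Sum>j\<in>{..n}. d j * poly (c j b) x) = 0" by auto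
  have "(\<Sum>j\<le>n. d j * a ^ j) = (\<Sum>j\<le>n. \<Sum>b\<in>monomials. d j * poly (c j b) x * mono_val b)"
    by (simp add: c(1) sum_distrib_left mult.assoc)
  also have "\<dots> = (\<Sum>b\<in>monomials. (\<Sum>j\<le>n. d j * poly (c j b) x) * mono_val b)"
    by (subst sum.swap) (simp add: sum_distrib_right)
  also have "\<dots> = 0" using d(3) by (intro sum.neutral) auto
  finally have rel: "(\<Sum>j\<le>n. d j * a ^ j) = 0" .
  define l where "l = (LEAST j. j \<le> n \<and> d j \<noteq> 0)"
  have l: "l \<le> n" "d l \<noteq> 0" unfolding l_def using LeastI_ex[OF d(2)] by auto
  have below: "d j = 0" if "j < l" for j
    using not_less_Least[of j "\<lambda>j. j \<le> n \<and> d j \<noteq> 0"] that l(1) unfolding l_def[symmetric] by auto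
  define b where "b = (\<Sum>j\<in>{l<..n}. d j * a ^ (j - l - 1))"
  have split: "{..n} = {..<l} \<union> ({l} \<union> {l<..n})" using l by auto
  have "(\<Sum>j\<le>n. d j * a ^ j) = (\<Sum>j<l. d j * a ^ j) + (d l * a ^ l + (\<Sum>j\<in>{l<..n}. d j * a ^ j))"
    unfolding split by (subst sum.union_disjoint; auto)+
  also have "(\<Sum>j<l. d j * a ^ j) = 0" using below by simp
  also have "(\<Sum>j\<in>{l<..n}. d j * a ^ j) = (\<Sum>j\<in>{l<..n}. a ^ l * (a * (d j * a ^ (j - l - 1))))"
  proof (rule sum.cong)
    fix j assume "j \<in> {l<..n}"
    hence "a ^ j = a ^ (l + 1 + (j - l - 1))" by simp
    thus "d j * a ^ j = a ^ l * (a * (d j * a ^ (j - l - 1)))" unfolding power_add by simp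
  qed simp
  also have "\<dots> = a ^ l * (a * b)" by (simp add: b_def sum_distrib_left)
  finally have "a ^ l * (d l + a * b) = 0" using rel by (simp add: algebra_simps)
  hence "d l + a * b = 0" using a by simp
  hence "d l = a * b" by (rule sum_zeroD)
  moreover have "b \<in> coord_ring" unfolding b_def
    using poly_ring_subset d(1) coord_ring_power[OF a(1)]
    by (intro coord_ring_sum coord_ring.mult) auto
  ultimately show ?thesis using l d(1) by (metis atMost_iff)
qed

text \<open>By \<open>coord_ring_divides_poly\<close> these fractions are closed under inversion, so
  they form a subfield containing the generators. A denominator in \<open>K[x]\<close>, not merely
  in \<open>K[x, y]\<close>, is what later makes the relevant prime ideals meet
  \<open>K[x]\<close>.\<close>

lemma fraction_representation: "\<exists>a\<in>coord_ring. \<exists>b\<in>poly_ring. b \<noteq> 0 \<and> f = a / b"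
proof -
  define S where "S = {a / b | a b. a \<in> coord_ring \<and> b \<in> poly_ring \<and> b \<noteq> 0}"
  have emb: "a \<in> S" if "a \<in> coord_ring" for a
    unfolding S_def using that poly_ring_const[of 1] by (intro CollectI exI[of _ a] exI[of _ 1]) auto
  have S_add: "u + t \<in> S" if "u \<in> S" "t \<in> S" for u t
  proof -
    obtain a b c d where *: "u = a / b" "t = c / d" "a \<in> coord_ring" "c \<in> coord_ring"
      "b \<in> poly_ring" "d \<in> poly_ring" "b \<noteq> 0" "d \<noteq> 0" using \<open>u \<in> S\<close> \<open>t \<in> S\<close> by (auto simp: S_def)
    thus ?thesis unfolding S_def
      by (intro CollectI exI[of _ "a * d + c * b"] exI[of _ "b * d"])
         (auto simp: field_simps intro: coord_ring.intros poly_ring_mult poly_ring_subset)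
  qed
  have S_mult: "u * t \<in> S" if "u \<in> S" "t \<in> S" for u t
  proof -
    obtain a b c d where *: "u = a / b" "t = c / d" "a \<in> coord_ring" "c \<in> coord_ring"
      "b \<in> poly_ring" "d \<in> poly_ring" "b \<noteq> 0" "d \<noteq> 0" using \<open>u \<in> S\<close> \<open>t \<in> S\<close> by (auto simp: S_def)
    thus ?thesis unfolding S_def
      by (intro CollectI exI[of _ "a * c"] exI[of _ "b * d"])
         (auto simp: field_simps intro: coord_ring.intros poly_ring_mult)
  qed
  have S_inv: "inverse u \<in> S" if "u \<in> S" for u
  proof (cases "u = 0")
    case True thus ?thesis using that by simp
  next
    case False
    obtain a b where *: "u = a / b" "a \<in> coord_ring" "b \<in> poly_ring" "b \<noteq> 0"
      using \<open>u \<in> S\<close> by (auto simp: S_def)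
    hence "a \<noteq> 0" using False by auto
    then obtain c where c: "c \<in> coord_ring" "a * c \<in> poly_ring" "a * c \<noteq> 0"
      using coord_ring_divides_poly * by blast
    have "inverse u = (b * c) / (a * c)" unfolding *(1) using c *(4) by simp
    thus ?thesis unfolding S_def
      using c * by (intro CollectI exI[of _ "b * c"] exI[of _ "a * c"])
        (auto intro: coord_ring.intros poly_ring_subset)
  qed
  have "is_subfield S" unfolding is_subfield_def
    using emb S_add S_mult S_inv coord_ring.const by (auto simp: minus_eq)
  moreover have "K \<subseteq> S" "x \<in> S" "y \<in> S" using emb coord_ring.intros by auto
  ultimately have "S = UNIV" by (rule generated)
  thus ?thesis unfolding S_def by blast
qed

section \<open>The place at infinity\<close>

lemma x_nonzero: "x \<noteq> 0"
  using poly_x_eq_0_iff[OF polys_monom[of 1 1]] by (auto simp: poly_monom monom_eq_0_iff)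

lemma y_nonzero: "y \<noteq> 0"
proof
  assume "y = 0"
  hence "x ^ q0 * (x ^ q + x) = 0" using curve q0_pos by (simp add: zero_power)
  hence "x ^ q + x = 0" using x_nonzero by simp
  moreover have "poly (monom 1 q + monom 1 1) x = x ^ q + x" by (simp add: poly_monom)
  moreover have "monom 1 q + monom 1 1 \<in> polys_over K" by (intro polys_add polys_monom one_closed)
  ultimately have "monom 1 q + monom (1::'f) 1 = 0" using poly_x_eq_0_iff by metis
  hence "poly.coeff (monom 1 q + monom (1::'f) 1) q = 0" by simp
  moreover have "q \<noteq> 1" by presburger
  ultimately show False by simp
qed

text \<open>Each value is read off from the dominant terms of the curve equation and of the formulas
  for \<open>z ^ q0\<close> and \<open>w ^ q0\<close>. The factor \<open>e\<close> is a possible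
  ramification, which \<open>pole_x\<close> shows to be 1.\<close>

lemma pole_values:
  assumes v: "v \<in> places K" and vx: "v x < 0"
  shows "\<exists>e>0. v x = - e * int q \<and> v y = - e * int (q + q0) \<and>
    v z = - e * int (q + 2 * q0) \<and> v w = - e * int m \<and> z \<noteq> 0 \<and> w \<noteq> 0"
proof -
  note place = place_mult[OF v] place_power[OF v]
  define Q0 where "Q0 = int q0"
  have Q0: "Q0 \<ge> 1" "Q0 * Q0 \<ge> 1" using q0_pos mult_mono[of 1 Q0 1 Q0] by (auto simp: Q0_def)
  have Qnz: "Q0 \<noteq> 0" using Q0 by simp
  have qQ: "int q = 2 * Q0 * Q0" by (simp add: Q0_def power2_eq_square)
  have lt: "c * a < b * a" if "b < c" "a < 0" for a b c :: int
    using that by (simp add: mult_less_cancel_right)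
  have less: "v (x ^ q) < v x"
    using lt[of 1 "int q" "v x"] vx Q0 qQ by (simp add: place)
  have "x ^ q + x \<noteq> 0" "v (x ^ q + x) = 2 * Q0 * Q0 * v x"
    using place_add_less[OF v _ less] x_nonzero qQ by (auto simp: place)
  hence rhs: "v (x ^ q0 * (x ^ q + x)) = (Q0 + 2 * Q0 * Q0) * v x"
    using x_nonzero by (simp add: place Q0_def distrib_right)
  have neg: "(Q0 + 2 * Q0 * Q0) * v x < 0" using vx Q0 by (intro mult_pos_neg) auto
  have vy: "v y < 0"
  proof (rule ccontr)
    assume "\<not> v y < 0"
    hence "0 \<le> v (y ^ q + y)" by (intro place_nonneg_add[OF v]) (auto simp: place)
    thus False using rhs neg unfolding curve by simp
  qed
  have less: "v (y ^ q) < v y"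
    using lt[of 1 "int q" "v y"] vy Q0 qQ by (simp add: place)
  have "v (y ^ q + y) = 2 * Q0 * Q0 * v y"
    using place_add_less[OF v _ less] y_nonzero by (simp add: place Q0_def power2_eq_square)
  hence "Q0 * (2 * Q0 * v y) = Q0 * ((2 * Q0 + 1) * v x)"
    using rhs unfolding curve by (simp add: algebra_simps)
  hence xy: "2 * Q0 * v y = (2 * Q0 + 1) * v x" by (rule int_mult_cancel[OF Qnz])
  define k where "k = v x - v y"
  have X: "v x = - (2 * Q0 * k)" using xy by (simp add: k_def algebra_simps)
  have Y: "v y = - ((2 * Q0 + 1) * k)" using X by (simp add: k_def algebra_simps)
  have k: "k > 0" using vx X Q0 by (smt (verit) mult_nonneg_nonpos)
  have less: "v (x ^ (q0 + 1)) < v y"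
  proof -
    have "v (x ^ (q0 + 1)) = - ((2 * Q0 * Q0 + 2 * Q0) * k)"
      unfolding place_power[OF v] X by (simp add: Q0_def algebra_simps)
    moreover have "(2 * Q0 + 1) * k < (2 * Q0 * Q0 + 2 * Q0) * k"
      using Q0 k by (intro mult_strict_right_mono) auto
    ultimately show ?thesis using Y by linarith
  qed
  hence s: "x ^ (q0 + 1) + y \<noteq> 0" "v (x ^ (q0 + 1) + y) = (Q0 + 1) * v x"
    using place_add_less[OF v _ less] x_nonzero by (auto simp: place Q0_def distrib_right)
  have z0: "z \<noteq> 0" using z_power_q0 s(1) q0_pos by (auto simp: add.commute zero_power)
  have "Q0 * v z = (Q0 + 1) * v x" using s(2) z_power_q0 place_power[OF v, of z q0]
    by (simp add: add.commute Q0_def)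
  hence "Q0 * v z = Q0 * (- (2 * (Q0 + 1) * k))" unfolding X by (simp add: algebra_simps)
  hence Z: "v z = - (2 * (Q0 + 1) * k)" by (rule int_mult_cancel[OF Qnz])
  have vxy: "v (x ^ q0 * y) = - ((2 * Q0 * Q0 + 2 * Q0 + 1) * k)"
    using x_nonzero y_nonzero by (simp add: place X Y Q0_def algebra_simps)
  have less: "v (x ^ q0 * y) < v z"
  proof -
    have "(2 * (Q0 + 1)) * k < (2 * Q0 * Q0 + 2 * Q0 + 1) * k"
      using Q0 k by (intro mult_strict_right_mono) auto
    thus ?thesis using vxy Z by linarith
  qed
  have s: "x ^ q0 * y + z \<noteq> 0" "v (x ^ q0 * y + z) = - ((2 * Q0 * Q0 + 2 * Q0 + 1) * k)"
    using place_add_less[OF v _ less] x_nonzero y_nonzero vxy by auto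
  have w0: "w \<noteq> 0" using w_power_q0 s(1) q0_pos by (auto simp: zero_power)
  have W: "Q0 * v w = - ((2 * Q0 * Q0 + 2 * Q0 + 1) * k)"
    using s(2) w_power_q0 place_power[OF v, of w q0] by (simp add: Q0_def)
  \<comment> \<open>Since \<open>m\<close> is 1 modulo \<open>q0\<close>, the relation
    \<open>W\<close> makes \<open>k\<close> divisible by \<open>q0\<close>; \<open>e\<close> is the
    quotient in explicit form.\<close>
  define e where "e = - v w - (2 * Q0 + 2) * k"
  have ke: "k = Q0 * e" unfolding e_def using W by (simp add: algebra_simps)
  have e: "e > 0" using k ke Q0 by (smt (verit) mult_nonneg_nonpos)
  have "Q0 * v w = Q0 * (- ((2 * Q0 * Q0 + 2 * Q0 + 1) * e))" unfolding W ke by (simp add: algebra_simps)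
  hence "v w = - ((2 * Q0 * Q0 + 2 * Q0 + 1) * e)" by (rule int_mult_cancel[OF Qnz])
  thus ?thesis using e z0 w0 X Y Z
    by (intro exI[of _ e]) (simp add: ke Q0_def power2_eq_square algebra_simps)
qed

text \<open>A mixed-radix expansion: \<open>k\<close> is the residue modulo \<open>q0\<close>; once
  \<open>2 * k\<close> is removed from the quotient, \<open>i + 2 * j\<close> is its residue modulo
  \<open>2 * q0\<close>, and parity separates \<open>i\<close> from \<open>j\<close>.\<close>

lemma pole_order_inj:
  assumes "b \<in> monomials" "b' \<in> monomials" "q * d + pole_order b = q * d' + pole_order b'"
  shows "b = b'"
proof -
  obtain i j k i' j' k' where b: "b = (i, j, k)" "b' = (i', j', k')" "i < 2" "j < q0" "k < q0"
    "i' < 2" "j' < q0" "k' < q0" using assms by (auto simp: monomials_def)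
  have expand: "q * d + pole_order (i, j, k) = q0 * (2 * q0 * (d + i + j + k) + i + 2 * j + 2 * k) + k" for d i j k
    by (simp add: pole_order_def power2_eq_square algebra_simps)
  have "(q0 * (2 * q0 * (d + i + j + k) + i + 2 * j + 2 * k) + k) mod q0 =
        (q0 * (2 * q0 * (d' + i' + j' + k') + i' + 2 * j' + 2 * k') + k') mod q0"
    using assms(3) unfolding b(1,2) expand by simp
  hence k: "k = k'" using b by simp
  have "2 * q0 * (d + i + j + k) + i + 2 * j + 2 * k = 2 * q0 * (d' + i' + j' + k') + i' + 2 * j' + 2 * k'"
    using assms(3) q0_pos unfolding b(1,2) expand k by simp
  hence "2 * q0 * (d + i + j + k) + (i + 2 * j) = 2 * q0 * (d' + i' + j' + k) + (i' + 2 * j')"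
    using k by simp
  hence "(2 * q0 * (d + i + j + k) + (i + 2 * j)) mod (2 * q0) = (2 * q0 * (d' + i' + j' + k) + (i' + 2 * j')) mod (2 * q0)"
    by simp
  hence "i + 2 * j = i' + 2 * j'" using b by simp
  thus ?thesis using b k by (simp; presburger)
qed

lemma mono_val_pole:
  assumes v: "v \<in> places K" and vx: "v x < 0"
  shows "mono_val b \<noteq> 0 \<and> int q * v (mono_val b) = v x * int (pole_order b)"
proof -
  obtain e where e: "v x = - e * int q" "v y = - e * int (q + q0)"
    "v z = - e * int (q + 2 * q0)" "v w = - e * int m" "z \<noteq> 0" "w \<noteq> 0"
    using pole_values[OF v vx] by blast
  obtain i j k where b: "b = (i, j, k)" by (cases b)
  have "v (mono_val b) = - e * int (pole_order b)"
  proof -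
    have "v (mono_val b) = int i * v y + int j * v z + int k * v w"
      using e(5,6) y_nonzero by (simp add: b mono_val_def place_mult[OF v] place_power[OF v])
    also have "\<dots> = - e * int (pole_order b)"
      unfolding e(2-4) b pole_order_def by (simp add: algebra_simps)
    finally show ?thesis .
  qed
  thus ?thesis using e y_nonzero by (simp add: b mono_val_def)
qed

text \<open>No two terms have the same pole order, so the largest decides. The monomial and the
  degree are chosen before \<open>v\<close>: one number governs the values at all poles of
  \<open>x\<close>, and this is what leaves room for only one such place.\<close>

lemma coord_ring_pole:
  assumes a: "a \<in> coord_ring" "a \<noteq> 0"
  shows "\<exists>b\<in>monomials. \<exists>d::nat. \<forall>v\<in>places K. v x < 0 \<longrightarrow> int q * v a = v x * int (q * d + pole_order b)"
proof -
  obtain c where c: "a = (\<Sum>b\<in>monomials. poly (c b) x * mono_val b)"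
    "\<forall>b\<in>monomials. c b \<in> polys_over K"
    using coord_ring_in_span[OF a(1)] by (auto simp: mono_span_def)
  define N where "N = {b \<in> monomials. c b \<noteq> 0}"
  define ht where "ht = (\<lambda>b. q * degree (c b) + pole_order b)"
  have fin: "finite N" using finite_monomials by (simp add: N_def)
  have "N \<noteq> {}"
  proof
    assume "N = {}"
    hence "a = 0" unfolding c(1) N_def by (intro sum.neutral) auto
    thus False using a by simp
  qed
  hence "Max (ht ` N) \<in> ht ` N" using fin by (intro Max_in) auto
  then obtain b where bN: "b \<in> N" "Max (ht ` N) = ht b" by auto
  have b: "b \<in> N" "\<And>b'. b' \<in> N \<Longrightarrow> ht b' \<le> ht b"
    using bN fin by (auto simp flip: bN(2))
  have "int q * v a = v x * int (ht b)" if v: "v \<in> places K" and vx: "v x < 0" for v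
  proof -
    have q: "int q > 0" using q0_pos by simp
    have val: "poly (c b') x * mono_val b' \<noteq> 0 \<and> int q * v (poly (c b') x * mono_val b') = v x * int (ht b')"
      if "b' \<in> N" for b'
      using place_poly[OF v vx, of "c b'"] mono_val_pole[OF v vx, of b'] that c(2)
      unfolding N_def ht_def by (auto simp: place_mult[OF v] algebra_simps)
    have "v a = v (poly (c b) x * mono_val b)" unfolding c(1)
    proof (rule conjunct2[OF place_sum_dominant[OF v]])
      fix b' assume b': "b' \<in> monomials" "b' \<noteq> b"
      show "poly (c b') x * mono_val b' = 0 \<or>
        v (poly (c b) x * mono_val b) < v (poly (c b') x * mono_val b')"
      proof (cases "b' \<in> N")
        case True
        have "ht b' \<noteq> ht b" using pole_order_inj[of b' b] b b' unfolding ht_def N_def by auto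
        hence "ht b' < ht b" using b(2)[OF True] by simp
        hence "v x * int (ht b) < v x * int (ht b')" using vx by simp
        hence "int q * v (poly (c b) x * mono_val b) < int q * v (poly (c b') x * mono_val b')"
          using val[OF True] val[OF b(1)] by simp
        thus ?thesis using q by simp
      qed (use b' N_def in auto)
    qed (use b val finite_monomials N_def in auto)
    thus ?thesis using val[OF b(1)] by simp
  qed
  thus ?thesis using b unfolding ht_def N_def by blast
qed

lemma pole_proportional:
  assumes "f \<noteq> 0"
  shows "\<exists>n::int. \<forall>v\<in>places K. v x < 0 \<longrightarrow> int q * v f = v x * n"
proof -
  obtain a b where ab: "a \<in> coord_ring" "b \<in> poly_ring" "b \<noteq> 0" "f = a / b"
    using fraction_representation by blast
  have a0: "a \<noteq> 0" using assms ab by auto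
  obtain n1 n2 :: int where n1: "\<And>v. v \<in> places K \<Longrightarrow> v x < 0 \<Longrightarrow> int q * v a = v x * n1"
    and n2: "\<And>v. v \<in> places K \<Longrightarrow> v x < 0 \<Longrightarrow> int q * v b = v x * n2"
    using coord_ring_pole[OF ab(1) a0] coord_ring_pole[OF poly_ring_subset[OF ab(2)] ab(3)] by metis
  have "int q * v f = v x * (n1 - n2)" if "v \<in> places K" "v x < 0" for v
    using n1[OF that] n2[OF that] place_divide[OF that(1) a0 ab(3)] ab(4)
    by (simp add: right_diff_distrib)
  thus ?thesis by blast
qed

text \<open>By \<open>pole_proportional\<close> every value is a multiple of \<open>e\<close>, and
  some element has value 1.\<close>

lemma pole_x:
  assumes v: "v \<in> places K" and vx: "v x < 0"
  shows "v x = - int q"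
proof -
  obtain e where e: "e > 0" "v x = - e * int q" using pole_values[OF v vx] by blast
  obtain t where t: "t \<noteq> 0" "v t = 1" using v by (auto simp: places_def)
  obtain n where "int q * v t = v x * n" using pole_proportional[OF t(1)] v vx by blast
  hence "int q * 1 = int q * (e * (- n))" unfolding e t by algebra
  hence "1 = e * (- n)" by (rule int_mult_cancel[OF q_nonzero])
  hence "e dvd 1" by (rule dvdI)
  thus ?thesis using e by simp
qed

lemma pole_unique:
  assumes "v \<in> places K" "v x < 0" "v' \<in> places K" "v' x < 0"
  shows "v = v'"
proof
  fix f
  show "v f = v' f"
  proof (cases "f = 0")
    case False
    then obtain n where "int q * v f = v x * n" "int q * v' f = v' x * n"
      using pole_proportional assms by blast
    hence "int q * v f = int q * v' f"
      by (simp only: pole_x[OF assms(1,2)] pole_x[OF assms(3,4)])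
    thus ?thesis by (rule int_mult_cancel[OF q_nonzero])
  qed (use assms place_zero in metis)
qed

lemma pole_all:
  assumes v: "v \<in> places K" and vx: "v x < 0"
  shows "v x = - int q" "v y = - int (q + q0)" "v z = - int (q + 2 * q0)" "v w = - int m"
    "z \<noteq> 0" "w \<noteq> 0"
proof -
  obtain e where e: "v x = - e * int q" "v y = - e * int (q + q0)"
    "v z = - e * int (q + 2 * q0)" "v w = - e * int m" "z \<noteq> 0" "w \<noteq> 0"
    using pole_values[OF v vx] by blast
  have "e * int q = 1 * int q" using pole_x[OF assms] e(1) by simp
  hence "e = 1" using q0_pos by simp
  thus "v x = - int q" "v y = - int (q + q0)" "v z = - int (q + 2 * q0)" "v w = - int m"
    "z \<noteq> 0" "w \<noteq> 0" using e by auto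
qed

text \<open>The excluded order is 2g - 1. It lies exactly \<open>q\<close> below the pole order of
  the largest monomial, which alone occupies its residue class modulo \<open>q\<close>; reaching it
  would take a negative power of \<open>x\<close>.\<close>

lemma coord_ring_not_canonical_order:
  assumes v: "v \<in> places K" "v x < 0" and a: "a \<in> coord_ring" "a \<noteq> 0"
  shows "v a \<noteq> - (2 * (int q0 - 1) * int m + 1)"
proof
  assume eq: "v a = - (2 * (int q0 - 1) * int m + 1)"
  obtain b d where b: "b \<in> monomials" "int q * v a = v x * int (q * d + pole_order b)"
    using coord_ring_pole[OF a] v by blast
  obtain i j k where ijk: "b = (i, j, k)" "i < 2" "j < q0" "k < q0"
    using b(1) by (auto simp: monomials_def)
  have "int q * v a = int q * (- int (q * d + pole_order b))"
    using b(2) by (simp only: pole_x[OF v] mult_minus_left mult_minus_right)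
  hence "v a = - int (q * d + pole_order b)" by (rule int_mult_cancel[OF q_nonzero])
  hence main: "int (q * d + pole_order b) = 2 * (int q0 - 1) * int m + 1" using eq by simp
  have top: "int (q * (d + 1) + pole_order b) = int (q * 0 + pole_order (1, q0 - 1, q0 - 1))"
  proof -
    obtain n where n: "q0 = Suc n" using q0_pos by (cases q0) auto
    have "int (pole_order (1, q0 - 1, q0 - 1)) = 2 * (int q0 - 1) * int m + 1 + int q"
      unfolding pole_order_def unfolding n by (simp add: power2_eq_square algebra_simps)
    thus ?thesis using main by simp
  qed
  hence "b = (1, q0 - 1, q0 - 1)"
    using b(1) q0_pos by (intro pole_order_inj[of _ _ "d + 1" 0]) (auto simp: monomials_def simp del: of_nat_add of_nat_mult)
  hence "q * (d + 1) = 0" using top by (simp del: of_nat_add of_nat_mult)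
  thus False using q0_pos by simp
qed

end

section \<open>Places centred on the affine curve\<close>

context suzuki
begin

definition ring_ideal :: "'f set \<Rightarrow> bool" where
  "ring_ideal M \<longleftrightarrow> M \<subseteq> coord_ring \<and> 0 \<in> M \<and> (\<forall>a\<in>M. \<forall>b\<in>M. a + b \<in> M) \<and>
     (\<forall>a\<in>coord_ring. \<forall>b\<in>M. a * b \<in> M)"

text \<open>An ideal maximal among the proper ones above \<open>J\<close> is prime, because
  adjoining any further element must produce 1.\<close>

lemma exists_prime_ideal:
  assumes J: "ring_ideal J" "1 \<notin> J"
  shows "\<exists>M. ring_ideal M \<and> 1 \<notin> M \<and> J \<subseteq> M \<and>
    (\<forall>a\<in>coord_ring. \<forall>b\<in>coord_ring. a * b \<in> M \<longrightarrow> a \<in> M \<or> b \<in> M)"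
proof -
  define F where "F = {M. ring_ideal M \<and> 1 \<notin> M \<and> J \<subseteq> M}"
  have "\<exists>M\<in>F. \<forall>N\<in>F. M \<subseteq> N \<longrightarrow> N = M"
  proof (rule subset_Zorn_nonempty)
    show "F \<noteq> {}" using J by (auto simp: F_def)
    fix C assume C: "C \<noteq> {}" "subset.chain F C"
    have CF: "N \<in> F" if "N \<in> C" for N using C(2) that by (auto simp: subset.chain_def)
    have "a + b \<in> \<Union>C" if ab: "a \<in> \<Union>C" "b \<in> \<Union>C" for a b
    proof -
      obtain N1 N2 where N: "N1 \<in> C" "N2 \<in> C" "a \<in> N1" "b \<in> N2" using ab by blast
      hence "N1 \<subseteq> N2 \<or> N2 \<subseteq> N1" using C(2) by (auto simp: subset.chain_def)
      then obtain N where "N \<in> C" "a \<in> N" "b \<in> N" using N by blast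
      thus ?thesis using CF[of N] by (auto simp: F_def ring_ideal_def)
    qed
    moreover have "a * b \<in> \<Union>C" if "a \<in> coord_ring" "b \<in> \<Union>C" for a b
      using that CF by (fastforce simp: F_def ring_ideal_def)
    moreover have "\<Union>C \<subseteq> coord_ring"
    proof
      fix a assume "a \<in> \<Union>C"
      then obtain N where "N \<in> C" "a \<in> N" by blast
      thus "a \<in> coord_ring" using CF[of N] by (auto simp: F_def ring_ideal_def)
    qed
    moreover have "0 \<in> \<Union>C" "1 \<notin> \<Union>C" "J \<subseteq> \<Union>C"
      using CF C(1) by (auto simp: F_def ring_ideal_def)
    ultimately show "\<Union>C \<in> F" unfolding F_def ring_ideal_def by blast
  qed
  then obtain M where M: "M \<in> F" "\<And>N. N \<in> F \<Longrightarrow> M \<subseteq> N \<Longrightarrow> N = M" by blast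
  have MI: "ring_ideal M" "1 \<notin> M" "J \<subseteq> M" using M(1) by (auto simp: F_def)
  have "a \<in> M \<or> b \<in> M" if ab: "a \<in> coord_ring" "b \<in> coord_ring" "a * b \<in> M" for a b
  proof (rule ccontr)
    assume neg: "\<not> (a \<in> M \<or> b \<in> M)"
    define N where "N = {u + r * a | u r. u \<in> M \<and> r \<in> coord_ring}"
    have "ring_ideal N" unfolding ring_ideal_def
    proof (intro conjI ballI)
      show "N \<subseteq> coord_ring" using MI(1) ab(1) unfolding N_def ring_ideal_def
        by (auto intro!: coord_ring.add coord_ring.mult)
      show "0 \<in> N" unfolding N_def using MI(1) coord_ring.const[of 0]
        by (intro CollectI exI[of _ 0]) (auto simp: ring_ideal_def)
      show "s + t \<in> N" if "s \<in> N" "t \<in> N" for s t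
      proof -
        obtain u r u' r' where *: "s = u + r * a" "t = u' + r' * a" "u \<in> M" "u' \<in> M"
          "r \<in> coord_ring" "r' \<in> coord_ring" using \<open>s \<in> N\<close> \<open>t \<in> N\<close> unfolding N_def by blast
        have "s + t = (u + u') + (r + r') * a" using * by (simp add: algebra_simps)
        thus ?thesis unfolding N_def using * MI(1) coord_ring.add unfolding ring_ideal_def by blast
      qed
      show "s * t \<in> N" if "s \<in> coord_ring" "t \<in> N" for s t
      proof -
        obtain u r where *: "t = u + r * a" "u \<in> M" "r \<in> coord_ring"
          using \<open>t \<in> N\<close> unfolding N_def by blast
        have "s * t = s * u + (s * r) * a" using * by (simp add: algebra_simps)
        thus ?thesis unfolding N_def using * that(1) MI(1) coord_ring.mult unfolding ring_ideal_def by blast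
      qed
    qed
    moreover have sub: "M \<subseteq> N"
    proof
      fix u assume "u \<in> M"
      thus "u \<in> N" unfolding N_def using coord_ring.const[of 0]
        by (intro CollectI exI[of _ u] exI[of _ 0]) auto
    qed
    moreover have "1 \<notin> N"
    proof
      assume "1 \<in> N"
      then obtain u r where *: "1 = u + r * a" "u \<in> M" "r \<in> coord_ring" unfolding N_def by blast
      have "b = (u + r * a) * b" unfolding *(1)[symmetric] by simp
      hence "b = b * u + r * (a * b)" by (simp add: algebra_simps)
      moreover have "b * u \<in> M" "r * (a * b) \<in> M" using * ab MI(1) by (auto simp: ring_ideal_def)
      ultimately have "b \<in> M" using MI(1) unfolding ring_ideal_def by metis
      thus False using neg by simp
    qed
    ultimately have "N \<in> F" using MI(3) by (auto simp: F_def)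
    hence "N = M" using M(2) sub by blast
    moreover have "a \<in> N" unfolding N_def using MI(1) coord_ring.const[of 1]
      by (intro CollectI exI[of _ 0] exI[of _ 1]) (auto simp: ring_ideal_def)
    ultimately show False using neg by simp
  qed
  thus ?thesis using MI by blast
qed

end

section \<open>The local ring of \<open>K[x, y]\<close> at a prime ideal\<close>

locale suzuki_prime = suzuki +
  fixes M :: "'a set"
  assumes ideal: "ring_ideal M" and proper: "1 \<notin> M"
    and prime: "\<And>a b. a \<in> coord_ring \<Longrightarrow> b \<in> coord_ring \<Longrightarrow> a * b \<in> M \<Longrightarrow> a \<in> M \<or> b \<in> M"
    and meets_polys: "\<exists>a\<in>poly_ring. a \<noteq> 0 \<and> a \<in> M"
begin

lemma M_subset: "a \<in> M \<Longrightarrow> a \<in> coord_ring"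
  and M_add: "a \<in> M \<Longrightarrow> b \<in> M \<Longrightarrow> a + b \<in> M"
  and M_mult: "a \<in> coord_ring \<Longrightarrow> b \<in> M \<Longrightarrow> a * b \<in> M"
  and M_zero: "0 \<in> M"
  using ideal by (auto simp: ring_ideal_def)

lemma M_power: "a \<in> coord_ring \<Longrightarrow> a ^ n \<in> M \<Longrightarrow> a \<in> M"
proof (induction n)
  case (Suc n)
  thus ?case using prime[of a "a ^ n"] coord_ring_power by auto
qed (use proper in auto)

definition units :: "'a set" where "units = {s \<in> coord_ring. s \<notin> M}"

lemma units_mult: "s \<in> units \<Longrightarrow> t \<in> units \<Longrightarrow> s * t \<in> units"
  using prime coord_ring.mult by (auto simp: units_def)

lemma units_nonzero: "s \<in> units \<Longrightarrow> s \<noteq> 0"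
  using M_zero by (auto simp: units_def)

lemma units_coord: "s \<in> units \<Longrightarrow> s \<in> coord_ring"
  by (simp add: units_def)

lemma one_unit: "1 \<in> units"
  using proper coord_ring.const[of 1] by (auto simp: units_def)

text \<open>An element of least degree generates the contraction of \<open>M\<close> to
  \<open>K[x]\<close>; it is not constant because nonzero constants are invertible.\<close>

lemma exists_generator:
  "\<exists>g\<in>polys_over K. g \<noteq> 0 \<and> degree g > 0 \<and> poly g x \<in> M \<and>
     (\<forall>h\<in>polys_over K. poly h x \<in> M \<longrightarrow> (\<exists>s\<in>polys_over K. h = s * g))"
proof -
  define P where "P = (\<lambda>g. g \<in> polys_over K \<and> g \<noteq> 0 \<and> poly g x \<in> M)"
  obtain a where a: "a \<in> poly_ring" "a \<noteq> 0" "a \<in> M" using meets_polys by blast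
  then obtain g0 where "g0 \<in> polys_over K" "a = poly g0 x" by (auto simp: poly_ring_def)
  hence "P g0" using a unfolding P_def by auto
  then obtain g where g: "P g" "\<And>h. P h \<Longrightarrow> degree g \<le> degree h"
    using ex_has_least_nat[of P g0 degree] by blast
  have gP: "g \<in> polys_over K" "g \<noteq> 0" "poly g x \<in> M" using g(1) by (auto simp: P_def)
  have "degree g > 0"
  proof (rule ccontr)
    assume "\<not> degree g > 0"
    then obtain c where c: "g = [:c:]" by (metis degree_eq_zeroE neq0_conv)
    hence "c \<in> K" "c \<noteq> 0" "c \<in> M" using gP polys_over_coeff[of g K 0] by auto
    hence "inverse c * c \<in> M" by (intro M_mult coord_ring.const inverse_closed)
    thus False using proper \<open>c \<noteq> 0\<close> by simp
  qed
  moreover have "\<exists>s\<in>polys_over K. h = s * g" if h: "h \<in> polys_over K" "poly h x \<in> M" for h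
  proof -
    obtain s r where sr: "s \<in> polys_over K" "r \<in> polys_over K" "h = s * g + r"
      "r = 0 \<or> degree r < degree g" using polys_division[OF gP(1,2) h(1)] by blast
    have "poly r x = poly h x + poly s x * poly g x" unfolding sr(3) by (simp add: algebra_simps)
    also have "\<dots> \<in> M" using h gP sr by (intro M_add M_mult poly_ring_subset poly_ringI)
    finally have "r = 0 \<or> P r" using sr(2) by (auto simp: P_def)
    hence "r = 0" using g(2) sr(4) by force
    thus ?thesis using sr by auto
  qed
  ultimately show ?thesis using gP by blast
qed

definition generator :: "'a poly" where
  "generator = (SOME g. g \<in> polys_over K \<and> g \<noteq> 0 \<and> degree g > 0 \<and> poly g x \<in> M \<and>
     (\<forall>h\<in>polys_over K. poly h x \<in> M \<longrightarrow> (\<exists>s\<in>polys_over K. h = s * g)))"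

definition p :: 'a where "p = poly generator x"

lemma generator_in: "generator \<in> polys_over K"
  and generator_nonzero: "generator \<noteq> 0"
  and generator_degree: "degree generator > 0"
  and p_in_M: "p \<in> M"
  and generator_divides: "h \<in> polys_over K \<Longrightarrow> poly h x \<in> M \<Longrightarrow> \<exists>s\<in>polys_over K. h = s * generator"
  using someI_ex[of "\<lambda>g. g \<in> polys_over K \<and> g \<noteq> 0 \<and> degree g > 0 \<and> poly g x \<in> M \<and>
     (\<forall>h\<in>polys_over K. poly h x \<in> M \<longrightarrow> (\<exists>s\<in>polys_over K. h = s * g))"] exists_generator
  unfolding generator_def[symmetric] p_def by blast+

lemma p_in_coord_ring: "p \<in> coord_ring"
  and p_nonzero: "p \<noteq> 0"
  using generator_in generator_nonzero poly_ringI poly_x_eq_0_iff poly_ring_subset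
  unfolding p_def by auto

lemma p_divides:
  assumes "a \<in> poly_ring" "a \<in> M"
  shows "\<exists>s\<in>poly_ring. a = s * p"
  using assms generator_divides poly_ringI unfolding poly_ring_def p_def by fastforce

lemma poly_ring_factor:
  assumes "a \<in> poly_ring" "a \<noteq> 0"
  shows "\<exists>k. \<exists>u\<in>poly_ring. u \<notin> M \<and> a = u * p ^ k"
proof -
  obtain g where g: "g \<in> polys_over K" "a = poly g x" using assms by (auto simp: poly_ring_def)
  hence "g \<noteq> 0" using assms by auto
  with g show ?thesis
  proof (induction "degree g" arbitrary: g a rule: less_induct)
    case less
    show ?case
    proof (cases "a \<in> M")
      case False
      thus ?thesis using less.prems poly_ringI by (intro exI[of _ 0] bexI[of _ a]) auto
    next
      case True
      then obtain s where s: "s \<in> polys_over K" "g = s * generator"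
        using generator_divides less.prems by blast
      hence "s \<noteq> 0" using less.prems by auto
      hence "degree s < degree g" unfolding s(2)
        using generator_nonzero generator_degree by (simp add: degree_mult_eq)
      then obtain k u where "u \<in> poly_ring" "u \<notin> M" "poly s x = u * p ^ k"
        using less.hyps[of s "poly s x"] s \<open>s \<noteq> 0\<close> by blast
      thus ?thesis using less.prems(2) s(2)
        by (intro exI[of _ "Suc k"] bexI[of _ u]) (auto simp: p_def)
    qed
  qed
qed

text \<open>Congruence modulo the ideal generated by \<open>p\<close> in \<open>K[x, y]\<close>,
  which is finer than congruence modulo \<open>M\<close>. In characteristic 2 the sum is the
  difference.\<close>

definition cong_p :: "'a \<Rightarrow> 'a \<Rightarrow> bool" where
  "cong_p a b \<longleftrightarrow> (\<exists>h\<in>coord_ring. a + b = h * p)"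

lemma cong_p_mult:
  assumes "cong_p a b" "cong_p a' b'" "a \<in> coord_ring" "b' \<in> coord_ring"
  shows "cong_p (a * a') (b * b')"
proof -
  obtain h h' where h: "h \<in> coord_ring" "a + b = h * p" "h' \<in> coord_ring" "a' + b' = h' * p"
    using assms(1,2) by (auto simp: cong_p_def)
  have "a * a' + b * b' = a * (a' + b') + (a + b) * b'" by (simp add: algebra_simps)
  also have "\<dots> = (a * h' + h * b') * p" unfolding h(2,4) by (simp add: algebra_simps)
  finally show ?thesis unfolding cong_p_def
    using h assms by (intro bexI[of _ "a * h' + h * b'"]) (auto intro: coord_ring.add coord_ring.mult)
qed

lemma cong_p_add:
  assumes "cong_p a b" "cong_p a' b'"
  shows "cong_p (a + a') (b + b')"
proof -
  obtain h h' where h: "h \<in> coord_ring" "a + b = h * p" "h' \<in> coord_ring" "a' + b' = h' * p"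
    using assms by (auto simp: cong_p_def)
  have "a + a' + (b + b') = (a + b) + (a' + b')" by (simp add: algebra_simps)
  also have "\<dots> = (h + h') * p" unfolding h(2,4) by (simp add: algebra_simps)
  finally show ?thesis unfolding cong_p_def using h coord_ring.add by blast
qed

lemma cong_p_refl: "cong_p a a"
  using coord_ring.const[of 0] unfolding cong_p_def by (intro bexI[of _ 0]) auto

text \<open>By pigeonhole two Frobenius powers of \<open>x\<close> agree modulo \<open>p\<close>; primality removes the common
  Frobenius power.\<close>

lemma exists_frobenius_period_x: "\<exists>d. d > 0 \<and> cong_p (x ^ (q ^ d)) x"
proof -
  define X where "X = (\<lambda>n. monom (1::'a) (q ^ n))"
  have X: "X n \<in> polys_over K" "poly (X n) x = x ^ (q ^ n)" for n
    unfolding X_def by (auto intro: polys_monom simp: poly_monom)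
  have "\<forall>n. \<exists>r. r \<in> {g \<in> polys_over K. degree g < degree generator} \<and> (\<exists>s\<in>polys_over K. X n = s * generator + r)"
    using polys_division[OF generator_in generator_nonzero X(1)] generator_degree by (force simp: degree_0)
  then obtain r where r: "\<And>n. r n \<in> {g \<in> polys_over K. degree g < degree generator}"
    "\<And>n. \<exists>s\<in>polys_over K. X n = s * generator + r n" by metis
  have "finite (range r)"
    using finite_polys_degree[OF finite_K] r(1) by (meson finite_subset image_subsetI)
  hence "\<not> inj r" using finite_imageD infinite_UNIV_nat by blast
  then obtain i j where ij: "i < j" "r i = r j" by (metis injI linorder_neqE_nat)
  obtain s s' where s: "s \<in> polys_over K" "s' \<in> polys_over K"
    "X i = s * generator + r i" "X j = s' * generator + r j" using r(2) by meson
  define d where "d = j - i"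
  have "x ^ (q ^ j) + x ^ (q ^ i) = poly (X j) x + poly (X i) x" by (simp add: X)
  also have "\<dots> = (poly s x + poly s' x) * p" unfolding s(3,4) ij(2) p_def by (simp add: algebra_simps)
  also have "\<dots> \<in> M"
    using s p_in_M by (intro M_mult coord_ring.add poly_ring_subset poly_ringI)
  finally have "x ^ (q ^ j) + x ^ (q ^ i) \<in> M" .
  moreover have "q ^ j = q ^ d * q ^ i" unfolding power_add[symmetric] using ij(1) by (simp only: d_def le_add_diff_inverse2 less_imp_le)
  ultimately have "(x ^ (q ^ d) + x) ^ (q ^ i) \<in> M"
    by (simp only: frob_q_power power_mult)
  hence "x ^ (q ^ d) + x \<in> M"
    by (rule M_power[rotated]) (intro coord_ring.add coord_ring_power coord_ring.x)
  hence "\<exists>s\<in>poly_ring. x ^ (q ^ d) + x = s * p"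
    by (intro p_divides poly_ring_add poly_ring_power poly_ring_x)
  thus ?thesis unfolding cong_p_def using poly_ring_subset ij(1) d_def
    by (intro exI[of _ d]) auto
qed

lemma const_power_q_power: "c \<in> K \<Longrightarrow> c ^ (q ^ n) = c"
proof (induction n)
  case (Suc n)
  have "c ^ (q ^ Suc n) = (c ^ q) ^ (q ^ n)" unfolding power_Suc by (rule power_mult)
  thus ?case using Suc const_power_q by simp
qed simp

text \<open>The \<open>L\<close>-th power map fixes \<open>K[x]\<close> modulo \<open>p\<close> and
  sends \<open>y\<close> to \<open>y + C\<close> with \<open>C\<close> in \<open>K[x]\<close>.
  Applying it twice adds \<open>C\<close> twice, which vanishes in characteristic 2; hence
  \<open>N = L * L\<close>.\<close>

lemma coord_ring_frobenius_period: "\<exists>N>1. \<forall>a\<in>coord_ring. cong_p (a ^ N) a"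
proof -
  obtain d where d: "d > 0" "cong_p (x ^ (q ^ d)) x" using exists_frobenius_period_x by blast
  define L where "L = q ^ d"
  note frobL = frob_q_power[of _ _ d, folded L_def]
  have poly: "cong_p (poly g x ^ L) (poly g x)" if "g \<in> polys_over K" for g
    using that
  proof (induction g)
    case 0
    have "L > 0" using q0_pos by (simp add: L_def)
    thus ?case using cong_p_refl[of 0] by (simp add: zero_power)
  next
    case (pCons c g)
    have c: "c \<in> K" using polys_over_coeff[OF pCons.prems, of 0] by simp
    have g: "g \<in> polys_over K"
      using polys_over_coeff[OF pCons.prems, of "Suc _"] by (simp add: polys_over_def)
    have "cong_p (c ^ L + x ^ L * poly g x ^ L) (c + x * poly g x)"
      using c const_power_q_power[OF c, of d] cong_p_refl[of c] d(2) pCons.IH[OF g] poly_ring_subset[OF poly_ringI[OF g]]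
      by (intro cong_p_add cong_p_mult) (auto simp: L_def intro: coord_ring_power coord_ring.x)
    thus ?case by (simp add: frobL power_mult_distrib)
  qed
  have "\<exists>C\<in>poly_ring. y ^ (q ^ n) = y + C" for n
  proof (induction n)
    case 0
    show ?case using poly_ring_const[of 0] by (intro bexI[of _ 0]) auto
  next
    case (Suc n)
    then obtain C where C: "C \<in> poly_ring" "y ^ (q ^ n) = y + C" by blast
    have "y ^ (q ^ Suc n) = (y ^ (q ^ n)) ^ q" unfolding power_Suc2 by (rule power_mult)
    also have "\<dots> = y + (x ^ q0 * x ^ q + x ^ q0 * x + C ^ q)"
      unfolding C(2) frob_q y_power_q by (simp only: add.assoc)
    finally show ?case
      using C(1) by (metis poly_ring_add poly_ring_mult poly_ring_power poly_ring_x)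
  qed
  then obtain C where C: "C \<in> poly_ring" "y ^ L = y + C" unfolding L_def by blast
  obtain g where g: "g \<in> polys_over K" "C = poly g x" using C(1) by (auto simp: poly_ring_def)
  have "y ^ (L * L) = y + (C + C ^ L)" by (simp only: power_mult C(2) frobL add.assoc)
  moreover obtain h where "h \<in> coord_ring" "C + C ^ L = h * p"
    using poly[OF g(1)] unfolding g(2)[symmetric] cong_p_def by (auto simp: add.commute)
  ultimately have y: "cong_p (y ^ (L * L)) y" unfolding cong_p_def
    by (intro bexI[of _ h]) (simp_all add: add.commute)
  have twice: "cong_p (a ^ (L * L)) a" if a: "a \<in> coord_ring" "cong_p (a ^ L) a" for a
  proof -
    obtain h where h: "h \<in> coord_ring" "a ^ L + a = h * p" using a by (auto simp: cong_p_def)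
    have "a ^ (L * L) + a = (a ^ L + a) ^ L + (a ^ L + a)"
      by (simp add: frobL power_mult algebra_simps)
    also have "\<dots> = (h ^ L * p ^ (L - 1) + h) * p"
    proof -
      have "L = Suc (L - 1)" using q0_pos by (simp add: L_def)
      hence "p ^ L = p ^ (L - 1) * p" by (metis power_Suc2)
      thus ?thesis unfolding h(2) power_mult_distrib by (simp add: algebra_simps)
    qed
    finally show ?thesis unfolding cong_p_def
      using h(1) p_in_coord_ring by (metis coord_ring.add coord_ring.mult coord_ring_power)
  qed
  define N where "N = L * L"
  have frobN: "(a + b) ^ N = a ^ N + b ^ N" for a b :: 'a
    unfolding N_def power_mult frobL ..
  have "cong_p (a ^ N) a" if "a \<in> coord_ring" for a using that
  proof (induction a rule: coord_ring.induct)
    case (const c)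
    have "c ^ N = c" using const_power_q_power[OF const, of d] unfolding N_def power_mult L_def by simp
    thus ?case using cong_p_refl by simp
  next
    case x thus ?case unfolding N_def using d(2) by (intro twice coord_ring.x) (simp add: L_def)
  next
    case y show ?case unfolding N_def by fact
  next
    case (add a b) thus ?case using cong_p_add frobN by simp
  next
    case (mult a b) thus ?case using cong_p_mult coord_ring_power by (simp add: power_mult_distrib)
  qed
  moreover have "N > 1"
  proof -
    have "q > 1" using one_le_q0_square by linarith
    hence "L > 1" using d(1) unfolding L_def by (rule one_less_power)
    thus ?thesis unfolding N_def by (metis less_1_mult)
  qed
  ultimately show ?thesis by blast
qed

text \<open>The product \<open>(g ^ (N - 1) + 1) * g\<close> is divisible by \<open>p\<close>, and
  its first factor is 1 modulo \<open>M\<close>. Thus \<open>p\<close> generates \<open>M\<close>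
  after localization: the affine curve is unramified over the \<open>x\<close>-line.\<close>

lemma M_local_principal:
  assumes "g \<in> M"
  shows "\<exists>s\<in>units. \<exists>h\<in>coord_ring. s * g = h * p"
proof -
  obtain N where N: "N > 1" "\<forall>a\<in>coord_ring. cong_p (a ^ N) a" using coord_ring_frobenius_period by blast
  have gR: "g \<in> coord_ring" using assms M_subset by blast
  obtain h where h: "h \<in> coord_ring" "g ^ N + g = h * p" using N(2) gR by (auto simp: cong_p_def)
  obtain n where n: "N = Suc (Suc n)" using less_imp_Suc_add[OF N(1)] by auto
  define s where "s = g ^ Suc n + 1"
  have gn: "g ^ Suc n \<in> M" using M_mult[OF coord_ring_power[OF gR, of n] assms] by (simp add: mult.commute)
  have "s \<in> units" unfolding units_def
  proof (intro CollectI conjI notI)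
    show "s \<in> coord_ring" unfolding s_def
      by (intro coord_ring.add coord_ring_power gR coord_ring.const one_closed)
    assume "s \<in> M"
    hence "g ^ Suc n + s \<in> M" using gn M_add by blast
    thus False using proper by (simp only: s_def two_cancel)
  qed
  moreover have "s * g = h * p" using h(2) by (simp add: s_def n algebra_simps)
  ultimately show ?thesis using h(1) by blast
qed

text \<open>A multiple of \<open>a\<close> in \<open>K[x]\<close> bounds how often \<open>p\<close>
  divides \<open>a\<close> locally. At the largest exponent the cofactor is outside
  \<open>M\<close>, since otherwise \<open>M_local_principal\<close> would supply one more factor
  \<open>p\<close>.\<close>

lemma coord_ring_local_order:
  assumes a: "a \<in> coord_ring" "a \<noteq> 0"
  shows "\<exists>n. \<exists>s\<in>units. \<exists>t\<in>units. s * a = t * p ^ n"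
proof -
  obtain b where b: "b \<in> coord_ring" "a * b \<in> poly_ring" "a * b \<noteq> 0"
    using coord_ring_divides_poly[OF a] by blast
  obtain k u where u: "u \<in> poly_ring" "u \<notin> M" "a * b = u * p ^ k"
    using poly_ring_factor[OF b(2,3)] by blast
  define Pr where "Pr = (\<lambda>n. \<exists>s\<in>units. \<exists>h\<in>coord_ring. s * a = h * p ^ n)"
  have bound: "n \<le> k" if Pn: "Pr n" for n
  proof (rule ccontr)
    assume "\<not> n \<le> k"
    then obtain j where j: "n = k + Suc j" by (metis less_iff_Suc_add not_le add_Suc_right)
    obtain s h where s: "s \<in> units" "h \<in> coord_ring" "s * a = h * p ^ n" using Pn unfolding Pr_def by blast
    have "(s * u) * p ^ k = s * a * b" using u(3) by (simp add: algebra_simps)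
    also have "\<dots> = (h * b * p ^ j * p) * p ^ k" unfolding s(3) j power_add by (simp add: algebra_simps)
    finally have "s * u = h * b * p ^ j * p" using p_nonzero by simp
    moreover have "h * b * p ^ j * p \<in> M"
      using s b p_in_M p_in_coord_ring by (intro M_mult coord_ring.mult coord_ring_power)
    ultimately have "s \<in> M \<or> u \<in> M" using prime[of s u] s(1) units_coord poly_ring_subset u(1) by auto
    thus False using s(1) u(2) by (auto simp: units_def)
  qed
  have "Pr 0" unfolding Pr_def using one_unit a by (intro bexI[of _ 1] bexI[of _ a]) auto
  then obtain n where n: "Pr n" "\<And>n'. Pr n' \<Longrightarrow> n' \<le> n"
    using GreatestI_nat[of Pr 0 k] Greatest_le_nat[of Pr _ k] bound by metis
  obtain s h where s: "s \<in> units" "h \<in> coord_ring" "s * a = h * p ^ n" using n(1) unfolding Pr_def by blast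
  have "h \<notin> M"
  proof
    assume "h \<in> M"
    then obtain s' h' where s': "s' \<in> units" "h' \<in> coord_ring" "s' * h = h' * p"
      using M_local_principal by blast
    have "(s' * s) * a = s' * h * p ^ n" using s(3) by (simp add: algebra_simps)
    also have "\<dots> = h' * p ^ Suc n" unfolding s'(3) by (simp add: algebra_simps)
    finally have "Pr (Suc n)" unfolding Pr_def using s s' units_mult by blast
    thus False using n(2) by fastforce
  qed
  thus ?thesis using s by (auto simp: units_def)
qed

text \<open>\<open>f\<close> is the \<open>n\<close>-th power of \<open>p\<close> times a unit of
  the localization at \<open>M\<close>, written with the denominators cleared.\<close>

definition has_order :: "'a \<Rightarrow> int \<Rightarrow> bool" where
  "has_order f n \<longleftrightarrow> (\<exists>s\<in>units. \<exists>t\<in>units. s * f = t * p powi n)"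

lemma has_order_mult:
  assumes "has_order f n" "has_order g l"
  shows "has_order (f * g) (n + l)"
proof -
  obtain s t s' t' where *: "s \<in> units" "t \<in> units" "s * f = t * p powi n"
    "s' \<in> units" "t' \<in> units" "s' * g = t' * p powi l" using assms by (auto simp: has_order_def)
  have "(s * s') * (f * g) = (s * f) * (s' * g)" by (simp add: algebra_simps)
  also have "\<dots> = (t * t') * p powi (n + l)" unfolding *(3,6)
    using p_nonzero by (simp add: power_int_add algebra_simps)
  finally show ?thesis unfolding has_order_def using * units_mult by blast
qed

lemma has_order_inverse:
  assumes "has_order f n"
  shows "has_order (inverse f) (- n)"
proof -
  obtain s t where *: "s \<in> units" "t \<in> units" "s * f = t * p powi n"
    using assms by (auto simp: has_order_def)
  have "f \<noteq> 0" using *(3) units_nonzero[OF *(2)] p_nonzero by auto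
  hence "t * inverse f = s * p powi (- n)"
    using *(3) p_nonzero units_nonzero[OF *(1)] by (simp add: power_int_minus field_simps)
  thus ?thesis unfolding has_order_def using * by blast
qed

lemma has_order_ex:
  assumes "f \<noteq> 0"
  shows "\<exists>n. has_order f n"
proof -
  have ring: "\<exists>n. has_order a n" if a: "a \<in> coord_ring" "a \<noteq> 0" for a
  proof -
    obtain n s t where *: "s \<in> units" "t \<in> units" "s * a = t * p ^ n"
      using coord_ring_local_order[OF a] by blast
    thus ?thesis unfolding has_order_def by (intro exI[of _ "int n"]) auto
  qed
  obtain a b where ab: "a \<in> coord_ring" "b \<in> poly_ring" "b \<noteq> 0" "f = a / b"
    using fraction_representation by blast
  obtain n l where "has_order a n" "has_order b l"
    using ring[of a] ring[of b] ab assms poly_ring_subset by auto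
  hence "has_order (a * inverse b) (n + - l)" by (intro has_order_mult has_order_inverse)
  thus ?thesis using ab(4) by (auto simp: divide_inverse)
qed

lemma has_order_coord_ring_nonneg:
  assumes "a \<in> coord_ring" "has_order a n"
  shows "n \<ge> 0"
proof (rule ccontr)
  assume "\<not> n \<ge> 0"
  then obtain j where j: "n = - int (Suc j)" by (metis negD not_le)
  obtain s t where *: "s \<in> units" "t \<in> units" "s * a = t * p powi n"
    using assms by (auto simp: has_order_def)
  have "t = s * a * p ^ Suc j" unfolding *(3) j power_int_minus using p_nonzero
    by (simp del: power_Suc of_nat_Suc)
  also have "\<dots> = (s * a * p ^ j) * p" by (simp add: algebra_simps)
  also have "\<dots> \<in> M" using * assms(1) units_coord p_in_M p_in_coord_ring
    by (intro M_mult coord_ring.mult coord_ring_power) auto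
  finally show False using * by (simp add: units_def)
qed

text \<open>Dividing \<open>f\<close> by itself shows that 1 has both orders \<open>n - l\<close>
  and \<open>l - n\<close>, and orders of ring elements are nonnegative.\<close>

lemma has_order_unique:
  assumes "has_order f n" "has_order f l"
  shows "n = l"
proof -
  have "f \<noteq> 0"
    using assms(1) units_nonzero p_nonzero by (auto simp: has_order_def)
  hence "has_order 1 (n + - l)" "has_order 1 (l + - n)"
    using has_order_mult[OF assms(1) has_order_inverse[OF assms(2)]]
      has_order_mult[OF assms(2) has_order_inverse[OF assms(1)]] by auto
  thus ?thesis
    using has_order_coord_ring_nonneg[OF coord_ring.const[OF one_closed], of "n + - l"]
      has_order_coord_ring_nonneg[OF coord_ring.const[OF one_closed], of "l + - n"] by linarith
qed

definition val :: "'a \<Rightarrow> int" where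
  "val f = (if f = 0 then 0 else THE n. has_order f n)"

lemma val_has_order: "f \<noteq> 0 \<Longrightarrow> has_order f (val f)"
  using has_order_ex has_order_unique theI'[of "has_order f"] by (auto simp: val_def)

lemma val_eqI: "f \<noteq> 0 \<Longrightarrow> has_order f n \<Longrightarrow> val f = n"
  using has_order_unique val_has_order by blast

text \<open>Once the smaller power of \<open>p\<close> is taken out, the remaining sum
  \<open>h\<close> lies in the coordinate ring but may fall into \<open>M\<close>; its own
  nonnegative order is then added.\<close>

lemma val_add_le:
  assumes "a \<noteq> 0" "b \<noteq> 0" "a + b \<noteq> 0" "val a \<le> val b"
  shows "val a \<le> val (a + b)"
proof -
  obtain s t s' t' where *: "s \<in> units" "t \<in> units" "s * a = t * p powi val a"
    "s' \<in> units" "t' \<in> units" "s' * b = t' * p powi val b"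
    using val_has_order[of a] val_has_order[of b] assms by (auto simp: has_order_def)
  define k where "k = nat (val b - val a)"
  have pb: "p powi val b = p ^ k * p powi val a"
  proof -
    have "val b = int k + val a" using assms(4) by (simp add: k_def)
    thus ?thesis using p_nonzero by (simp only: power_int_add power_int_of_nat simp_thms)
  qed
  define h where "h = s' * t + s * t' * p ^ k"
  have h: "h \<in> coord_ring" unfolding h_def
    using * units_coord p_in_coord_ring by (intro coord_ring.add coord_ring.mult coord_ring_power) auto
  have "(s * s') * (a + b) = s' * (s * a) + s * (s' * b)" by (simp add: algebra_simps)
  also have "\<dots> = h * p powi val a" unfolding *(3,6) pb h_def by (simp add: algebra_simps)
  finally have eq: "(s * s') * (a + b) = h * p powi val a" .
  have ss: "s * s' \<in> units" using * units_mult by blast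
  have h0: "h \<noteq> 0" using eq units_nonzero[OF ss] assms(3) by auto
  obtain u t'' where u: "u \<in> units" "t'' \<in> units" "u * h = t'' * p powi val h"
    using val_has_order[OF h0] by (auto simp: has_order_def)
  have "(u * (s * s')) * (a + b) = u * h * p powi val a" using eq by (simp only: mult.assoc)
  also have "\<dots> = t'' * p powi (val h + val a)" unfolding u(3) using p_nonzero by (simp add: power_int_add)
  finally have "has_order (a + b) (val h + val a)" unfolding has_order_def
    using u ss units_mult by blast
  moreover have "val h \<ge> 0" using has_order_coord_ring_nonneg[OF h val_has_order[OF h0]] .
  ultimately show ?thesis using val_eqI assms(3) by force
qed

lemma val_place: "val \<in> places K"
  unfolding places_def
proof (intro CollectI conjI allI impI ballI)
  show "val 0 = 0" by (simp add: val_def)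
  show "val (a * b) = val a + val b" if "a \<noteq> 0" "b \<noteq> 0" for a b
    using that val_has_order by (intro val_eqI has_order_mult) auto
  show "min (val a) (val b) \<le> val (a + b)" if "a \<noteq> 0" "b \<noteq> 0" "a + b \<noteq> 0" for a b
    using val_add_le[of a b] val_add_le[of b a] that by (cases "val a \<le> val b") (auto simp: add.commute)
  have "has_order p 1" unfolding has_order_def using one_unit by (intro bexI[of _ 1]) auto
  thus "\<exists>t. t \<noteq> 0 \<and> val t = 1" using p_nonzero val_eqI by blast
  show "val c = 0" if "c \<in> K" "c \<noteq> 0" for c
  proof -
    have "c \<in> units" unfolding units_def
    proof (intro CollectI conjI notI)
      assume "c \<in> M"
      hence "inverse c * c \<in> M" using that by (intro M_mult coord_ring.const inverse_closed)
      thus False using that proper by simp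
    qed (use that coord_ring.const in auto)
    hence "has_order c 0" unfolding has_order_def using one_unit by (intro bexI[of _ 1] bexI[of _ c]) auto
    thus ?thesis using that val_eqI by blast
  qed
qed

end

context suzuki
begin

text \<open>If \<open>f\<close> were not in the coordinate ring, the ideal of its denominators would lie in a prime
  ideal whose place sees a pole of \<open>f\<close>.\<close>

lemma regular_in_coord_ring:
  assumes reg: "\<And>v. v \<in> places K \<Longrightarrow> v x \<ge> 0 \<Longrightarrow> v f \<ge> 0"
  shows "f \<in> coord_ring"
proof (rule ccontr)
  assume f: "f \<notin> coord_ring"
  hence f0: "f \<noteq> 0" using coord_ring.const[of 0] by auto
  define J where "J = {a \<in> coord_ring. a * f \<in> coord_ring}"
  have "ring_ideal J" unfolding ring_ideal_def J_def
    using coord_ring.const[of 0]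
    by (auto simp: distrib_right mult.assoc intro: coord_ring.add coord_ring.mult)
  moreover have "1 \<notin> J" using f by (simp add: J_def)
  ultimately obtain M where M: "ring_ideal M" "1 \<notin> M" "J \<subseteq> M"
    "\<And>a b. a \<in> coord_ring \<Longrightarrow> b \<in> coord_ring \<Longrightarrow> a * b \<in> M \<Longrightarrow> a \<in> M \<or> b \<in> M"
    using exists_prime_ideal by blast
  obtain a b where ab: "a \<in> coord_ring" "b \<in> poly_ring" "b \<noteq> 0" "f = a / b"
    using fraction_representation by blast
  have "b \<in> J" unfolding J_def using ab poly_ring_subset by simp
  hence "\<exists>a\<in>poly_ring. a \<noteq> 0 \<and> a \<in> M" using ab M by blast
  then interpret suzuki_prime K q0 x y M using M by unfold_locales auto
  have "val x \<ge> 0" using has_order_coord_ring_nonneg[OF coord_ring.x val_has_order[OF x_nonzero]] .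
  hence "val f \<ge> 0" using reg val_place by blast
  then obtain n where n: "val f = int n" by (metis nonneg_int_cases)
  obtain s t where *: "s \<in> units" "t \<in> units" "s * f = t * p ^ n"
    using val_has_order[OF f0] n by (auto simp: has_order_def)
  have "s * f \<in> coord_ring" unfolding *(3)
    using * units_coord p_in_coord_ring by (intro coord_ring.mult coord_ring_power) auto
  hence "s \<in> M" using M(3) * units_coord by (auto simp: J_def)
  thus False using * by (simp add: units_def)
qed

end

section \<open>Symmetries of the curve\<close>

lemma transcendental_of_pole:
  assumes "v \<in> places K" "v t < 0"
  shows "transcendental_over K t"
  unfolding transcendental_over_def using place_poly[OF assms] by (auto simp: polys_over_def)

context suzuki
begin

text \<open>Replacing \<open>x\<close> by \<open>x + a\<close> adds
  \<open>a ^ q0 * (x ^ q + x)\<close> to the right side of the curve equation, and this is exactly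
  what the term \<open>a ^ q0 * x\<close> adds to the left side.\<close>

lemma translate:
  assumes a: "a \<in> K" and b: "b \<in> K"
  shows "suzuki K q0 (x + a) (y + a ^ q0 * x + b)"
proof (rule suzuki.intro[OF subfield_axioms], unfold_locales)
  show "\<exists>s::nat. q0 = 2 ^ s" by (rule q0_power)
  show "card K = 2 * q0\<^sup>2" by (rule card_K)
  show "transcendental_over K (x + a)" unfolding transcendental_over_def
  proof (intro allI impI)
    fix g assume g: "(\<forall>i. poly.coeff g i \<in> K) \<and> poly g (x + a) = 0"
    have "pcompose h [:a, 1:] \<in> polys_over K" if "h \<in> polys_over K" for h using that
    proof (induction h)
      case (pCons c h)
      have "c \<in> K" "h \<in> polys_over K"
        using polys_over_coeff[OF pCons.prems, of 0] polys_over_coeff[OF pCons.prems, of "Suc _"]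
        by (auto simp: polys_over_def)
      moreover have "[:a, 1:] \<in> polys_over K"
        using a by (auto simp: polys_over_def coeff_pCons split: nat.splits)
      ultimately show ?case using pCons.IH by (simp only: pcompose_pCons polys_add polys_mult polys_const)
    qed simp
    hence "pcompose g [:a, 1:] \<in> polys_over K" using g by (simp add: polys_over_def)
    moreover have "poly (pcompose g [:a, 1:]) x = 0" using g by (simp add: poly_pcompose add.commute)
    ultimately have "pcompose g [:a, 1:] = 0" using poly_x_eq_0_iff by blast
    thus "g = 0" by (simp add: pcompose_eq_0)
  qed
  have aq: "(a ^ q0) ^ q = a ^ q0" by (rule const_power_q[OF power_closed[OF a]])
  have "(y + a ^ q0 * x + b) ^ q = y ^ q + a ^ q0 * x ^ q + b"
    by (simp only: frob_q power_mult_distrib aq const_power_q[OF b])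
  moreover have "(x + a) ^ q = x ^ q + a" by (simp only: frob_q const_power_q[OF a])
  moreover have "(x + a) ^ q0 = x ^ q0 + a ^ q0" by (rule frob_q0)
  ultimately show "(y + a ^ q0 * x + b) ^ (2 * q0\<^sup>2) + (y + a ^ q0 * x + b) =
      (x + a) ^ q0 * ((x + a) ^ (2 * q0\<^sup>2) + (x + a))"
    unfolding y_power_q by (simp add: algebra_simps)
next
  fix S assume S: "is_subfield S" "K \<subseteq> S" "x + a \<in> S" "y + a ^ q0 * x + b \<in> S"
  interpret S: subfield S using S(1) by unfold_locales
  have aS: "a \<in> S" "b \<in> S" using a b S(2) by auto
  have "x + a + a \<in> S" by (rule S.add_closed[OF S(3) aS(1)])
  hence x: "x \<in> S" by (simp add: add.assoc)
  have "(y + a ^ q0 * x + b) + (a ^ q0 * x + b) \<in> S"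
    using aS x by (intro S.add_closed[OF S(4)] S.add_closed S.mult_closed S.power_closed)
  hence "y \<in> S" by (simp add: algebra_simps)
  thus "S = UNIV" using generated S x by blast
qed

lemma w_power_2q0: "w ^ (2 * q0) = x ^ (2 * q0) * y ^ 2 + z ^ 2"
proof -
  have "w ^ (2 * q0) = (w ^ q0) ^ 2" by (simp add: mult.commute power_mult)
  also have "\<dots> = x ^ (2 * q0) * y ^ 2 + z ^ 2"
    unfolding w_power_q0 x_power_2q0 by (simp add: power2_eq_square algebra_simps)
  finally show ?thesis .
qed

lemma w_eq: "w = x * z + y ^ 2"
  by (simp add: y_square)

lemma x_power_z: "x ^ (2 * q0) * x = z + y ^ (2 * q0)"
  by (simp add: z_def add.assoc)

text \<open>Divided by \<open>w ^ (2 * q0 + 1)\<close>, this says that the involution sends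
  \<open>z\<close> to \<open>x / w\<close>, and \<open>involution_w\<close> says that it sends
  \<open>w\<close> to \<open>1 / w\<close>. Divided by \<open>w ^ (q0 + 1)\<close>,
  \<open>involution_curve\<close> is the image of \<open>z_power_q0\<close>.\<close>

lemma involution_z: "z ^ (2 * q0) * z + y ^ (2 * q0) * w = x * w ^ (2 * q0)"
proof -
  have zz: "z ^ (2 * q0) = w + x * y ^ (2 * q0)"
  proof -
    have "z ^ (2 * q0) = x * y ^ (2 * q0) + w" by (simp add: w_def)
    thus ?thesis by (simp add: add.commute)
  qed
  have "x * w ^ (2 * q0) = x ^ (2 * q0) * x * y ^ 2 + x * z ^ 2"
    unfolding w_power_2q0 by (simp add: algebra_simps)
  also have "\<dots> = z * w + y ^ (2 * q0) * y ^ 2"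
    unfolding x_power_z w_eq by (simp add: algebra_simps power2_eq_square)
  also have "\<dots> = z ^ (2 * q0) * z + y ^ (2 * q0) * w"
    unfolding zz by (subst (3) w_eq) (simp add: algebra_simps)
  finally show ?thesis ..
qed

lemma involution_w: "z * y ^ (2 * q0) + x ^ (2 * q0) * w = w ^ (2 * q0)"
proof -
  have "z * y ^ (2 * q0) + x ^ (2 * q0) * w = x ^ (2 * q0) * y ^ 2 + z * (x ^ (2 * q0) * x + y ^ (2 * q0))"
    unfolding w_eq by (simp add: algebra_simps)
  thus ?thesis unfolding x_power_z w_power_2q0 by (simp add: algebra_simps power2_eq_square)
qed

lemma involution_curve: "x ^ q0 * w = y * w ^ q0 + z ^ q0 * z"
  unfolding z_power_q0 w_power_q0 by (subst w_eq) (simp add: algebra_simps power2_eq_square)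

text \<open>The involution \<open>(x, y) \<mapsto> (z/w, y/w)\<close> exchanges the place at infinity and the origin; it maps
  \<open>z\<close> to \<open>x/w\<close> and \<open>w\<close> to \<open>1/w\<close>.\<close>

lemma involution:
  assumes v: "v \<in> places K" "v (z / w) < 0"
  shows "suzuki K q0 (z / w) (y / w)"
proof -
  have w0: "w \<noteq> 0" using v place_zero[OF v(1)] by auto
  define X where "X = z / w"
  define Y where "Y = y / w"
  have Z: "X ^ (2 * q0) * X + Y ^ (2 * q0) = x / w"
  proof -
    have "X ^ (2 * q0) * X + Y ^ (2 * q0) = (z ^ (2 * q0) * z + y ^ (2 * q0) * w) / (w ^ (2 * q0) * w)"
      unfolding X_def Y_def power_divide using w0 by (simp add: field_simps)
    thus ?thesis unfolding involution_z using w0 by simp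
  qed
  have W: "X * Y ^ (2 * q0) + (x / w) ^ (2 * q0) = 1 / w"
  proof -
    have "X * Y ^ (2 * q0) + (x / w) ^ (2 * q0) = (z * y ^ (2 * q0) + x ^ (2 * q0) * w) / (w ^ (2 * q0) * w)"
      unfolding X_def Y_def power_divide using w0 by (simp add: field_simps)
    thus ?thesis unfolding involution_w using w0 by simp
  qed
  have C: "(x / w) ^ q0 = Y + X ^ q0 * X"
  proof -
    have "Y + X ^ q0 * X = (y * w ^ q0 + z ^ q0 * z) / (w ^ q0 * w)"
      unfolding X_def Y_def power_divide using w0 by (simp add: field_simps)
    thus ?thesis unfolding involution_curve[symmetric] power_divide using w0 by simp
  qed
  \<comment> \<open>The \<open>q0\<close>-th power of \<open>Z\<close> and the relation
    \<open>C\<close> evaluate the same element; equating the two results is the curve equation for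
    \<open>X\<close> and \<open>Y\<close>.\<close>
  have "(x / w) ^ q0 = (X ^ (2 * q0)) ^ q0 * X ^ q0 + (Y ^ (2 * q0)) ^ q0"
    unfolding Z[symmetric] frob_q0 power_mult_distrib ..
  hence Yq: "X ^ q * X ^ q0 + Y ^ q = Y + X ^ q0 * X"
    using C by (simp add: power2_eq_square mult.assoc flip: power_mult)
  have curve': "Y ^ q + Y = X ^ q0 * (X ^ q + X)"
  proof -
    have "Y ^ q + Y = X ^ q * X ^ q0 + (X ^ q * X ^ q0 + Y ^ q) + Y" by (simp add: add.assoc)
    thus ?thesis unfolding Yq by (simp add: algebra_simps)
  qed
  have "suzuki K q0 X Y"
  proof (rule suzuki.intro[OF subfield_axioms], unfold_locales)
    show "\<exists>s::nat. q0 = 2 ^ s" by (rule q0_power)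
    show "card K = 2 * q0\<^sup>2" by (rule card_K)
    show "transcendental_over K X" using v unfolding X_def by (rule transcendental_of_pole)
    show "Y ^ (2 * q0\<^sup>2) + Y = X ^ q0 * (X ^ (2 * q0\<^sup>2) + X)" by (rule curve')
    fix S assume S: "is_subfield S" "K \<subseteq> S" "X \<in> S" "Y \<in> S"
    interpret S: subfield S using S(1) by unfold_locales
    have zS: "x / w \<in> S" unfolding Z[symmetric]
      using S(3,4) by (intro S.add_closed S.mult_closed S.power_closed)
    have "1 / w \<in> S" unfolding W[symmetric]
      using S(3,4) zS by (intro S.add_closed S.mult_closed S.power_closed)
    hence "inverse (1 / w) \<in> S" by (rule S.inverse_closed)
    hence wS: "w \<in> S" by simp
    have "x \<in> S" using S.mult_closed[OF zS wS] w0 by simp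
    moreover have "y \<in> S" using S.mult_closed[OF S(4) wS] w0 by (simp add: Y_def)
    ultimately show "S = UNIV" using generated S by blast
  qed
  thus ?thesis by (simp add: X_def Y_def)
qed

section \<open>The place at the origin and the choice of coordinates\<close>

lemma origin_values:
  assumes v: "v \<in> places K" and vx: "v x > 0" and vy: "v y > 0"
  shows "v y = (int q0 + 1) * v x" "v z = (2 * int q0 + 1) * v x" "v w = int m * v x"
    "z \<noteq> 0" "w \<noteq> 0"
proof -
  note place = place_mult[OF v] place_power[OF v]
  define Q0 where "Q0 = int q0"
  have Q0: "Q0 \<ge> 1" "Q0 * Q0 \<ge> 1" using q0_pos mult_mono[of 1 Q0 1 Q0] by (auto simp: Q0_def)
  have qQ: "int q = 2 * Q0 * Q0" by (simp add: Q0_def power2_eq_square)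
  have lt: "1 * a < int q * a" if "a > 0" for a :: int
    using that Q0 unfolding qQ by (intro mult_strict_right_mono) auto
  have less: "v x < v (x ^ q)" using lt[OF vx] by (simp only: place mult_1_left)
  have "x + x ^ q \<noteq> 0 \<and> v (x + x ^ q) = v x" using place_add_less[OF v x_nonzero less] .
  hence rhs: "v (x ^ q0 * (x ^ q + x)) = (Q0 + 1) * v x"
    using x_nonzero by (simp add: place Q0_def distrib_right add.commute)
  have less: "v y < v (y ^ q)" using lt[OF vy] by (simp only: place mult_1_left)
  have "v (y + y ^ q) = v y" using place_add_less[OF v y_nonzero less] by simp
  hence Y: "v y = (Q0 + 1) * v x" using rhs unfolding curve[symmetric] by (simp add: add.commute)
  thus "v y = (int q0 + 1) * v x" by (simp add: Q0_def)
  have vx1: "v (x ^ (2 * q0 + 1)) = (2 * Q0 + 1) * v x" unfolding place by (simp add: Q0_def)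
  have vy1: "v (y ^ (2 * q0)) = (2 * Q0 * Q0 + 2 * Q0) * v x" unfolding place Y by (simp add: Q0_def algebra_simps)
  have less: "v (x ^ (2 * q0 + 1)) < v (y ^ (2 * q0))" unfolding vx1 vy1
    using Q0 vx by (intro mult_strict_right_mono) auto
  have z: "z \<noteq> 0" "v z = (2 * Q0 + 1) * v x"
    using place_add_less[OF v _ less] x_nonzero vx1 unfolding z_def by auto
  thus "z \<noteq> 0" "v z = (2 * int q0 + 1) * v x" by (auto simp: Q0_def)
  have vz1: "v (z ^ (2 * q0)) = (4 * Q0 * Q0 + 2 * Q0) * v x" unfolding place z(2) by (simp add: Q0_def algebra_simps)
  have vxy: "v (x * y ^ (2 * q0)) = (2 * Q0 * Q0 + 2 * Q0 + 1) * v x"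
    using x_nonzero y_nonzero vy1 by (simp add: place_mult[OF v] distrib_right)
  have less: "v (x * y ^ (2 * q0)) < v (z ^ (2 * q0))" unfolding vxy vz1
    using Q0 vx by (intro mult_strict_right_mono) auto
  have "w \<noteq> 0" "v w = (2 * Q0 * Q0 + 2 * Q0 + 1) * v x"
    using place_add_less[OF v _ less] x_nonzero y_nonzero vxy unfolding w_def by auto
  thus "w \<noteq> 0" "v w = int m * v x" by (auto simp: Q0_def power2_eq_square mult.assoc)
qed

lemma origin_involution:
  assumes v: "v \<in> places K" and vx: "v x > 0" and vy: "v y > 0"
  shows "v (z / w) = - int q * v x" "v (z / w) < 0" "suzuki K q0 (z / w) (y / w)"
proof -
  note val = origin_values[OF assms]
  show eq: "v (z / w) = - int q * v x"
    unfolding place_divide[OF v val(4,5)] val(2,3) by (simp add: algebra_simps)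
  show neg: "v (z / w) < 0" unfolding eq using vx q0_pos by (simp add: mult_neg_pos)
  show "suzuki K q0 (z / w) (y / w)" using involution[OF v neg] .
qed

text \<open>The involution turns the origin into a pole of \<open>z / w\<close> of order
  \<open>q * v x\<close>, and \<open>pole_x\<close> in the new coordinates says that this order is
  \<open>q\<close>.\<close>

lemma origin_x:
  assumes v: "v \<in> places K" and vx: "v x > 0" and vy: "v y > 0"
  shows "v x = 1"
proof -
  note inv = origin_involution[OF assms]
  have "v (z / w) = - int q" using suzuki.pole_x[OF inv(3) v inv(2)] .
  hence "int q * v x = int q * 1" using inv(1) by simp
  thus ?thesis by (rule int_mult_cancel[OF q_nonzero])
qed

lemma origin_unique:
  assumes "v \<in> places K" "v x > 0" "v y > 0" "v' \<in> places K" "v' x > 0" "v' y > 0"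
  shows "v = v'"
  using suzuki.pole_unique[of K q0 "z / w" "y / w" v v'] origin_involution assms by blast

text \<open>\<open>y\<close> is integral over \<open>K[x]\<close>: at a pole of \<open>y\<close> the
  term \<open>y ^ q\<close> would dominate the curve equation.\<close>

lemma y_nonneg:
  assumes v: "v \<in> places K" and vx: "v x \<ge> 0"
  shows "v y \<ge> 0"
proof (rule ccontr)
  assume neg: "\<not> v y \<ge> 0"
  have "int 2 \<le> int q" using one_le_q0_square by (simp only: of_nat_le_iff)
  hence "2 * v y \<ge> int q * v y"
    using neg by (intro mult_right_mono_neg) simp_all
  hence less: "v (y ^ q) < v y" using neg by (simp only: place_power[OF v])
  have "v (y ^ q + y) = v (y ^ q)" using place_add_less[OF v _ less] y_nonzero by simp
  hence "v (y ^ q + y) < 0" using less neg by simp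
  moreover have "v (x ^ q0 * (x ^ q + x)) \<ge> 0"
    using vx by (intro place_nonneg_mult[OF v] place_nonneg_add[OF v]) (auto simp: place_power[OF v])
  ultimately show False using curve by simp
qed

lemma coord_ring_nonneg:
  assumes v: "v \<in> places K" and vx: "v x \<ge> 0" and a: "a \<in> coord_ring"
  shows "v a \<ge> 0"
  using a by (induction a rule: coord_ring.induct)
    (auto simp: vx y_nonneg[OF v vx] place_const[OF v] intro: place_nonneg_add[OF v] place_nonneg_mult[OF v])

text \<open>Rationality provides residues in \<open>K\<close> of \<open>x\<close> and of
  \<open>y + a ^ q0 * x\<close>, and the translation by them is used. It keeps poles of
  \<open>x\<close> poles, so the place at infinity stays where it is.\<close>

lemma move_to_origin:
  assumes v: "v \<in> rational_places K" and vx: "v x \<ge> 0"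
  shows "\<exists>x' y'. suzuki K q0 x' y' \<and> v x' > 0 \<and> v y' > 0 \<and> (\<forall>u\<in>places K. u x < 0 \<longrightarrow> u x' < 0)"
proof -
  have vp: "v \<in> places K" and rat: "\<And>f. 0 \<le> v f \<Longrightarrow> \<exists>c\<in>K. f = c \<or> 0 < v (f - c)"
    using v by (auto simp: rational_places_def)
  obtain a where a: "a \<in> K" "x = a \<or> 0 < v (x - a)" using rat[OF vx] by blast
  define Y where "Y = y + a ^ q0 * x"
  have "v Y \<ge> 0" unfolding Y_def using y_nonneg[OF vp vx] vx
    by (intro place_nonneg_add[OF vp] place_nonneg_mult[OF vp])
       (auto simp: place_const[OF vp] power_closed a(1))
  then obtain b where b: "b \<in> K" "Y = b \<or> 0 < v (Y - b)" using rat by blast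
  have tr: "suzuki K q0 (x + a) (Y + b)" using translate[OF a(1) b(1)] by (simp add: Y_def)
  have "x + a \<noteq> 0" "Y + b \<noteq> 0" using suzuki.x_nonzero[OF tr] suzuki.y_nonzero[OF tr] by auto
  hence "v (x + a) > 0" "v (Y + b) > 0" using a(2) b(2) by (auto simp: diff_eq)
  moreover have "u (x + a) < 0" if u: "u \<in> places K" "u x < 0" for u
    using place_add_less[OF u(1) x_nonzero, of a] place_const[OF u(1) a(1)] u(2) by simp
  ultimately show ?thesis using tr by blast
qed

end

text \<open>If \<open>P\<close> is affine, it is first brought to infinity by way of the origin and
  the involution. Then \<open>Q\<close> is affine because infinity carries only one place, and a
  translation moves it without disturbing \<open>P\<close>.\<close>

lemma exists_normalised_coordinates:
  assumes X: "suzuki K q0 x y" and P: "P \<in> rational_places K" and Q: "Q \<in> rational_places K"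
    and PQ: "P \<noteq> Q"
  shows "\<exists>x' y'. suzuki K q0 x' y' \<and> P x' < 0 \<and> Q x' > 0 \<and> Q y' > 0"
proof -
  have places: "P \<in> places K" "Q \<in> places K" using P Q by (auto simp: rational_places_def)
  obtain x1 y1 where 1: "suzuki K q0 x1 y1" "P x1 < 0"
  proof (cases "P x < 0")
    case True thus ?thesis using X that by blast
  next
    case False
    then obtain x' y' where *: "suzuki K q0 x' y'" "P x' > 0" "P y' > 0"
      using suzuki.move_to_origin[OF X P] by auto
    interpret S: suzuki K q0 x' y' by (rule *(1))
    show ?thesis using that S.origin_involution(2,3)[OF places(1) *(2,3)] by blast
  qed
  have "Q x1 \<ge> 0" using suzuki.pole_unique[OF 1(1) places(1) 1(2) places(2)] PQ by force
  then obtain x2 y2 where "suzuki K q0 x2 y2" "Q x2 > 0" "Q y2 > 0"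
    "\<forall>u\<in>places K. u x1 < 0 \<longrightarrow> u x2 < 0"
    using suzuki.move_to_origin[OF 1(1) Q] by blast
  thus ?thesis using 1(2) places(1) by blast
qed

section \<open>Discrepancies supported in two points\<close>

locale suzuki_points = suzuki +
  fixes P Q :: "'a \<Rightarrow> int"
  assumes P: "P \<in> places K" and Q: "Q \<in> rational_places K"
    and Px: "P x < 0" and Qx: "Q x > 0" and Qy: "Q y > 0"
begin

lemma Q_place: "Q \<in> places K" using Q by (simp add: rational_places_def)

lemma P_neq_Q: "P \<noteq> Q" using Px Qx by auto

lemmas P_values = pole_all[OF P Px]

lemma Q_values: "Q x = 1" "Q y = int q0 + 1" "Q z = 2 * int q0 + 1" "Q w = int m"
  using origin_x[OF Q_place Qx Qy] origin_values[OF Q_place Qx Qy] by auto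

lemma x_nonneg: "v \<in> places K \<Longrightarrow> v \<noteq> P \<Longrightarrow> v x \<ge> 0"
  using pole_unique[OF P Px] by force

text \<open>At an affine zero of \<open>w\<close> the identity \<open>yz\<close> makes
  \<open>y\<close> or \<open>z\<close> vanish; each forces the other, and together they force
  \<open>x\<close> to vanish. The origin is the only such place.\<close>

lemma w_no_other_zeros:
  assumes v: "v \<in> places K" "v \<noteq> P" "v \<noteq> Q"
  shows "v w = 0"
proof (rule ccontr)
  assume "v w \<noteq> 0"
  note place = place_mult[OF v(1)] place_power[OF v(1)] and add = place_add[OF v(1)]
  note nz = x_nonzero y_nonzero P_values(5,6)
  have nn: "v a \<ge> 0" if "a \<in> coord_ring" for a
    using coord_ring_nonneg[OF v(1) x_nonneg[OF v(1,2)] that] .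
  have vx: "v x \<ge> 0" and vy: "v y \<ge> 0" and vz: "v z \<ge> 0" and vw: "v w > 0"
    using nn[OF coord_ring.x] nn[OF coord_ring.y] nn[OF z_in_coord_ring] nn[OF w_in_coord_ring] \<open>v w \<noteq> 0\<close>
    by auto
  have q0v: "int q0 * a > 0 \<longleftrightarrow> a > 0" for a using q0_pos by (simp add: zero_less_mult_iff)
  have yz: "y * z ^ q0 = w + x * w ^ q0"
  proof -
    have "y * z ^ q0 = y ^ 2 + x * (x ^ q0 * y)" unfolding z_power_q0 by (simp add: power2_eq_square algebra_simps)
    thus ?thesis unfolding y_square w_power_q0 by (simp add: algebra_simps)
  qed
  have "min (v w) (v (x * w ^ q0)) \<le> v (y * z ^ q0)"
    unfolding yz using nz yz by (intro add) (auto simp flip: yz)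
  moreover have "v (x * w ^ q0) > 0" using nz vx vw q0_pos by (simp add: place add_nonneg_pos)
  ultimately have "v y + int q0 * v z > 0" using vw nz by (simp add: place)
  hence "v y > 0 \<or> v z > 0" using vy vz q0v by (metis add_nonpos_nonpos not_le)
  moreover have "v z > 0" if "v y > 0"
  proof -
    have zz: "z = x ^ q0 * y + w ^ q0" unfolding w_power_q0 by (simp add: algebra_simps)
    have "min (v (x ^ q0 * y)) (v (w ^ q0)) \<le> v (x ^ q0 * y + w ^ q0)"
      by (rule add) (use nz in \<open>auto simp flip: zz\<close>)
    hence "min (v (x ^ q0 * y)) (v (w ^ q0)) \<le> v z" unfolding zz[symmetric] .
    moreover have "v (x ^ q0 * y) > 0" "v (w ^ q0) > 0"
      using nz vx vw that q0_pos by (auto simp: place add_nonneg_pos)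
    ultimately show ?thesis by simp
  qed
  moreover have "v y > 0" if "v z > 0"
  proof -
    have "min (v (x * z)) (v w) \<le> v (y ^ 2)"
      unfolding y_square using nz by (intro add) (auto simp flip: y_square)
    moreover have "v (x * z) > 0" using nz vx that by (simp add: place)
    ultimately show ?thesis using vw by (simp add: place)
  qed
  ultimately have pos: "v y > 0" "v z > 0" by auto
  have xx: "x ^ (q0 + 1) = z ^ q0 + y" unfolding z_power_q0 by (simp add: algebra_simps)
  have "min (v (z ^ q0)) (v y) \<le> v (x ^ (q0 + 1))"
    unfolding xx by (rule add) (use nz in \<open>auto simp flip: xx\<close>)
  moreover have "v (z ^ q0) > 0" using pos q0_pos by (simp add: place)
  ultimately have "int (q0 + 1) * v x > 0" using pos(1) by (simp only: place)
  hence "v x > 0" by (simp only: zero_less_mult_iff) auto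
  hence "v = Q" using origin_unique[OF v(1) _ pos(1) Q_place Qx Qy] by blast
  thus False using v by simp
qed

section \<open>Discrepancies \<open>i P + j Q\<close> as pairs of integers\<close>

definition reg :: "'a \<Rightarrow> bool" where
  "reg f \<longleftrightarrow> f \<noteq> 0 \<and> (\<forall>v\<in>places K. v \<noteq> P \<longrightarrow> v \<noteq> Q \<longrightarrow> v f \<ge> 0)"

text \<open>A function in L(A) but not in L(A - P) has order exactly \<open>- i\<close> at
  \<open>P\<close>; the bound \<open>- j + 1\<close> is the one imposed by A - Q.\<close>

definition disc :: "int \<Rightarrow> int \<Rightarrow> bool" where
  "disc i j \<longleftrightarrow> (\<exists>f. reg f \<and> P f = - i \<and> Q f \<ge> - j) \<and>
     \<not> (\<exists>f. reg f \<and> P f = - i \<and> Q f \<ge> - j + 1)"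

lemma reg_mult: "reg f \<Longrightarrow> reg g \<Longrightarrow> reg (f * g)"
  by (auto simp: reg_def intro: place_nonneg_mult)

lemma reg_coord_ring: "a \<in> coord_ring \<Longrightarrow> a \<noteq> 0 \<Longrightarrow> reg a"
  using coord_ring_nonneg x_nonneg by (auto simp: reg_def)

lemma disc_not_less:
  assumes "disc i j" "disc i' j"
  shows "\<not> i < i'"
proof
  assume less: "i < i'"
  \<comment> \<open>The order at \<open>Q\<close> is exactly \<open>- j\<close>, because a larger
    one is excluded by the second condition.\<close>
  obtain f where f: "reg f" "P f = - i" "Q f = - j"
    using assms(1) unfolding disc_def by (metis add1_zle_eq order_le_less)
  obtain f' where f': "reg f'" "P f' = - i'" "Q f' = - j"
    using assms(2) unfolding disc_def by (metis add1_zle_eq order_le_less)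
  have nz: "f \<noteq> 0" "f' \<noteq> 0" using f(1) f'(1) by (auto simp: reg_def)
  have Qr: "Q (f' / f) = 0" using place_divide[OF Q_place nz(2,1)] f f' by simp
  hence "0 \<le> Q (f' / f)" by simp
  \<comment> \<open>Rationality of \<open>Q\<close> puts the residue of \<open>f' / f\<close> into
    \<open>K\<close>. Subtracting \<open>c * f\<close> from \<open>f'\<close> raises the order at
    \<open>Q\<close> and, because of \<open>i < i'\<close>, keeps the order of \<open>f'\<close> at
    \<open>P\<close>.\<close>
  then obtain c where c: "c \<in> K" "f' / f = c \<or> 0 < Q (f' / f - c)"
    using Q unfolding rational_places_def by blast
  have c0: "c \<noteq> 0" using c(2) Qr nz by auto
  have Pcf: "P (- (c * f)) = - i"
    using place_const[OF P c(1)] nz c0 f(2) by (simp add: place_uminus[OF P] place_mult[OF P])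
  have "f' / f \<noteq> c"
  proof
    assume "f' / f = c"
    hence "f' = c * f" using nz by (simp add: field_simps)
    thus False using Pcf f'(2) less by (simp add: place_uminus[OF P])
  qed
  hence r: "0 < Q (f' / f - c)" "f' / f - c \<noteq> 0" using c by auto
  define g where "g = f' + - (c * f)"
  have "P f' < P (- (c * f))" using Pcf f'(2) less by simp
  hence "f' + - (c * f) \<noteq> 0 \<and> P (f' + - (c * f)) = P f'" by (rule place_add_less[OF P nz(2)])
  hence Pg: "g \<noteq> 0" "P g = - i'" unfolding g_def f'(2) by blast+
  have "g = f * (f' / f - c)" using nz by (simp add: g_def field_simps)
  hence "Q g = Q f + Q (f' / f - c)" using place_mult[OF Q_place nz(1) r(2)] by simp
  hence "Q g \<ge> - j + 1" using r(1) f(3) by simp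
  moreover have "reg g" unfolding reg_def
  proof (intro conjI ballI impI)
    fix v assume v: "v \<in> places K" "v \<noteq> P" "v \<noteq> Q"
    have "v f \<ge> 0" "v f' \<ge> 0" using f(1) f'(1) v by (auto simp: reg_def)
    thus "v g \<ge> 0" unfolding g_def using place_const[OF v(1) c(1)]
      by (intro place_nonneg_add[OF v(1)]) (auto simp: place_uminus[OF v(1)] intro: place_nonneg_mult[OF v(1)])
  qed (rule Pg)
  ultimately show False using assms(2) Pg unfolding disc_def by blast
qed

lemma disc_unique: "disc i j \<Longrightarrow> disc i' j \<Longrightarrow> i = i'"
  using disc_not_less by (meson linorder_neqE)

lemma disc_shift:
  assumes h: "h \<noteq> 0" "\<And>v. v \<in> places K \<Longrightarrow> v \<noteq> P \<Longrightarrow> v \<noteq> Q \<Longrightarrow> v h = 0" and d: "disc i j"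
  shows "disc (i - P h) (j - Q h)"
proof -
  have reg_h: "reg h" "reg (inverse h)" by (auto simp: reg_def h place_inverse)
  obtain f where f: "reg f" "P f = - i" "Q f \<ge> - j" using d by (auto simp: disc_def)
  have "f \<noteq> 0" using f by (simp add: reg_def)
  hence "P (f * h) = - (i - P h)" "Q (f * h) \<ge> - (j - Q h)"
    using f h(1) by (auto simp: place_mult[OF P] place_mult[OF Q_place])
  moreover have False if g: "reg g" "P g = - (i - P h)" "Q g \<ge> - (j - Q h) + 1" for g
  proof -
    have "g \<noteq> 0" using g by (simp add: reg_def)
    hence "P (g * inverse h) = - i" "Q (g * inverse h) \<ge> - j + 1"
      using g h(1) by (auto simp: place_mult[OF P] place_mult[OF Q_place]
          place_inverse[OF P] place_inverse[OF Q_place])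
    thus False using d reg_mult[OF g(1) reg_h(2)] by (auto simp: disc_def)
  qed
  ultimately show ?thesis unfolding disc_def using reg_mult[OF f(1) reg_h(1)] by blast
qed

text \<open>\<open>f'\<close> witnesses the dual class \<open>K + P + Q - A\<close> of \<open>A = i P + j Q\<close>. A function contradicting
  the second condition would, multiplied by \<open>f'/w\<close>, have a single pole of the gap order \<open>2g - 1\<close>.\<close>

lemma disc_dual:
  assumes f: "reg f" "P f = - i" "Q f = - j"
    and f': "reg f'" "P f' = i - 2 * int q0 * (int q + int q0)" "Q f' = j + 2 * int q0 * (int q0 + 1)"
  shows "disc i j"
proof -
  have False if g: "reg g" "P g = - i" "Q g \<ge> - j + 1" for g
  proof -
    \<comment> \<open>The constants in the hypotheses are \<open>2 * q0 * (q + q0)\<close> = 2g - 1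
      + m and \<open>2 * q0 * (q0 + 1)\<close> = m - 1. They place \<open>f'\<close> in the dual
      class shifted by m (P - Q), and the division by \<open>w\<close> undoes the shift.\<close>
    define h where "h = g * f' / w"
    have nz: "g \<noteq> 0" "f' \<noteq> 0" "w \<noteq> 0" using g f' P_values(6) by (auto simp: reg_def)
    have val: "v h = v g + v f' - v w" if "v \<in> places K" for v
      using nz that by (simp add: h_def place_divide place_mult)
    have "h \<in> coord_ring"
    proof (rule regular_in_coord_ring)
      fix v assume v: "v \<in> places K" "v x \<ge> 0"
      hence "v \<noteq> P" using Px by auto
      show "v h \<ge> 0"
      proof (cases "v = Q")
        \<comment> \<open>The extra 1 in the bound for \<open>g\<close> is just enough: the order of
          \<open>h\<close> at \<open>Q\<close> is at least (- j + 1) + (j + m - 1) - m = 0.\<close>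
        case True
        thus ?thesis using val[OF Q_place] g(3) f'(3) Q_values(4)
          by (simp add: algebra_simps power2_eq_square)
      next
        case False
        thus ?thesis using val[OF v(1)] w_no_other_zeros[OF v(1)] v g(1) f'(1) \<open>v \<noteq> P\<close>
          by (simp add: reg_def)
      qed
    qed
    moreover have "h \<noteq> 0" using nz by (simp add: h_def)
    moreover have "P h = - (2 * (int q0 - 1) * int m + 1)"
      using val[OF P] g(2) f'(2) P_values(4) by (simp add: algebra_simps power2_eq_square)
    ultimately show False using coord_ring_not_canonical_order[OF P Px] by blast
  qed
  thus ?thesis unfolding disc_def using f by fastforce
qed

end

section \<open>The index set\<close>

definition diamond :: "nat \<Rightarrow> (int \<times> int) set" where
  "diamond n = {(a, b). \<bar>a\<bar> + \<bar>b\<bar> \<le> int n}"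

definition rectangles :: "nat \<Rightarrow> (nat \<times> nat + nat \<times> nat) set" where
  "rectangles n = ({0..n} \<times> {0..n}) <+> ({0..n - 1} \<times> {0..n - 1})"

text \<open>\<open>a + n\<close> counts the copies of \<open>H\<close>, one from each of
  \<open>E0\<close>, \<open>E1\<close>, \<open>E2\<close>, whence the additional 1 in the second
  family; \<open>b\<close> is the excess of \<open>E0\<close> over \<open>E2\<close>.\<close>

definition to_diamond :: "nat \<Rightarrow> nat \<times> nat + nat \<times> nat \<Rightarrow> int \<times> int" where
  "to_diamond n = case_sum (\<lambda>(i, j). (int i + int j - int n, int i - int j))
     (\<lambda>(i, j). (int i + int j + 1 - int n, int i - int j))"

definition from_diamond :: "nat \<Rightarrow> int \<times> int \<Rightarrow> nat \<times> nat + nat \<times> nat" where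
  "from_diamond n = (\<lambda>(a, b). if even (a + b + int n)
     then Inl (nat ((a + b + int n) div 2), nat ((a - b + int n) div 2))
     else Inr (nat ((a + b + int n) div 2), nat ((a - b + int n) div 2)))"

lemma from_diamond_even: "a + b + int n = 2 * k \<Longrightarrow> from_diamond n (a, b) = Inl (nat k, nat (k - b))"
proof -
  assume k: "a + b + int n = 2 * k"
  hence "a - b + int n = 2 * (k - b)" by simp
  thus ?thesis unfolding from_diamond_def prod.case k
    by (simp only: nonzero_mult_div_cancel_left zero_neq_numeral not_False_eq_True dvd_triv_left if_True)
qed

lemma from_diamond_odd: "a + b + int n = 2 * k + 1 \<Longrightarrow> from_diamond n (a, b) = Inr (nat k, nat (k - b))"
proof -
  assume k: "a + b + int n = 2 * k + 1"
  hence l: "a - b + int n = 2 * (k - b) + 1" by simp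
  have "odd (2 * k + 1)" "(2 * k + 1) div 2 = k" "(2 * (k - b) + 1) div 2 = k - b" by presburger+
  thus ?thesis unfolding from_diamond_def prod.case k l by (simp only: if_False)
qed

text \<open>In the coordinates a + b and a - b the diamond is a square, and the parity of
  \<open>a + b + n\<close> splits its points into grids with sides \<open>n + 1\<close> and
  \<open>n\<close>. Positivity of \<open>n\<close> keeps \<open>n - 1\<close> from being
  truncated.\<close>

lemma bij_to_diamond:
  assumes "n > 0"
  shows "bij_betw (to_diamond n) (rectangles n) (diamond n)"
proof (rule bij_betw_byWitness[of _ "from_diamond n"])
  show "\<forall>s\<in>rectangles n. from_diamond n (to_diamond n s) = s"
  proof
    fix s show "from_diamond n (to_diamond n s) = s"
    proof (cases s)
      case (Inl ij)
      obtain i j where ij: "ij = (i, j)" by (cases ij)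
      show ?thesis using from_diamond_even[of "int i + int j - int n" "int i - int j" n "int i"]
        by (simp add: Inl ij to_diamond_def)
    next
      case (Inr ij)
      obtain i j where ij: "ij = (i, j)" by (cases ij)
      show ?thesis using from_diamond_odd[of "int i + int j + 1 - int n" "int i - int j" n "int i"]
        by (simp add: Inr ij to_diamond_def)
    qed
  qed
  have *: "to_diamond n (from_diamond n t) = t \<and> from_diamond n t \<in> rectangles n" if t: "t \<in> diamond n" for t
  proof -
    obtain a b where ab: "t = (a, b)" by (cases t)
    have le: "\<bar>a\<bar> + \<bar>b\<bar> \<le> int n" using t by (simp add: diamond_def ab)
    show ?thesis
    proof (cases "even (a + b + int n)")
      case True
      then obtain k where k: "a + b + int n = 2 * k" by blast
      have "k \<ge> 0" "k - b \<ge> 0" "k \<le> int n" "k - b \<le> int n" using k le by linarith+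
      thus ?thesis using k unfolding ab from_diamond_even[OF k]
        by (auto simp: to_diamond_def rectangles_def)
    next
      case False
      then obtain k where k: "a + b + int n = 2 * k + 1" by (elim oddE)
      have "k \<ge> 0" "k - b \<ge> 0" "k \<le> int n - 1" "k - b \<le> int n - 1" using k le by linarith+
      thus ?thesis using k assms unfolding ab from_diamond_odd[OF k]
        by (auto simp: to_diamond_def rectangles_def)
    qed
  qed
  show "\<forall>t\<in>diamond n. to_diamond n (from_diamond n t) = t"
    and "from_diamond n ` diamond n \<subseteq> rectangles n" using * by auto
  show "to_diamond n ` rectangles n \<subseteq> diamond n"
    using assms by (auto simp: rectangles_def to_diamond_def diamond_def)
qed

lemma card_diamond:
  assumes "n > 0"
  shows "card (diamond n) = 2 * n ^ 2 + 2 * n + 1" "finite (diamond n)"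
proof -
  have "card (rectangles n) = (n + 1) * (n + 1) + n * n"
    using assms unfolding rectangles_def by (subst card_Plus) auto
  moreover have "finite (rectangles n)" by (simp add: rectangles_def)
  ultimately show "card (diamond n) = 2 * n ^ 2 + 2 * n + 1" "finite (diamond n)"
    using bij_betw_same_card[OF bij_to_diamond[OF assms]] bij_betw_finite[OF bij_to_diamond[OF assms]]
    by (auto simp: power2_eq_square algebra_simps)
qed

text \<open>\<open>coordP\<close> and \<open>coordQ\<close> are the coefficients of \<open>P\<close>
  and \<open>Q\<close> in E(a,b) after \<open>H\<close> is replaced by m P.\<close>

definition coordP :: "nat \<Rightarrow> int \<times> int \<Rightarrow> int" where
  "coordP n = (\<lambda>(a, b). (a + int n) * (2 * int n ^ 2 + 2 * int n + 1) -
     ((a + int n) * (int n + 1) + b * int n))"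

definition coordQ :: "nat \<Rightarrow> int \<times> int \<Rightarrow> int" where
  "coordQ n = (\<lambda>(a, b). - ((a + int n) * (int n + 1) - b * int n))"

text \<open>Two points of the diamond differ by at most \<open>2 * n\<close> in the sum norm,
  whereas a nonzero Gaussian multiple of n + (n + 1) i has sum norm at least 2 n + 1.\<close>

lemma coordQ_inj:
  assumes n: "n > 0" and s: "s \<in> diamond n" and t: "t \<in> diamond n"
    and dvd: "(2 * int n ^ 2 + 2 * int n + 1) dvd coordQ n t - coordQ n s"
  shows "s = t"
proof -
  define N where "N = int n"
  define M where "M = 2 * N * N + 2 * N + 1"
  obtain a b a' b' where st: "s = (a, b)" "t = (a', b')" by (cases s, cases t)
  define \<alpha> where "\<alpha> = a - a'"
  define \<beta> where "\<beta> = b - b'"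
  have N: "N \<ge> 1" using n by (simp add: N_def)
  hence M0: "M \<noteq> 0" unfolding M_def by (smt (verit) mult_nonneg_nonneg)
  have "M = 2 * int n ^ 2 + 2 * int n + 1" by (simp add: M_def N_def power2_eq_square)
  moreover have "coordQ n t - coordQ n s = \<alpha> * (N + 1) - \<beta> * N"
    by (simp add: st coordQ_def \<alpha>_def \<beta>_def N_def algebra_simps)
  ultimately have "M dvd \<alpha> * (N + 1) - \<beta> * N" using dvd by simp
  then obtain l where l: "\<alpha> * (N + 1) - \<beta> * N = M * l" by blast
  text \<open>As \<open>M\<close> is the Gaussian norm of \<open>N + (N + 1) i\<close>, the difference \<open>\<alpha> + \<beta> i\<close> is a Gaussian
    multiple of it.\<close>
  have "N * \<alpha> + (N + 1) * \<beta> = M * ((N * \<alpha> + (N + 1) * \<beta>) - (2 * N + 2) * (\<alpha> - (N + 1) * l))"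
    using l unfolding M_def by algebra
  then obtain k where k: "N * \<alpha> + (N + 1) * \<beta> = M * k" by blast
  have "M * \<alpha> = M * (N * k + (N + 1) * l)" using k l unfolding M_def by algebra
  hence A: "\<alpha> = N * k + (N + 1) * l" by (rule int_mult_cancel[OF M0])
  have "M * \<beta> = M * ((N + 1) * k - N * l)" using k l unfolding M_def by algebra
  hence B: "\<beta> = (N + 1) * k - N * l" by (rule int_mult_cancel[OF M0])
  have bnd: "\<bar>\<alpha>\<bar> + \<bar>\<beta>\<bar> \<le> 2 * N" using s t unfolding st diamond_def \<alpha>_def \<beta>_def N_def by auto
  define D where "D = 2 * N + 1"
  have D: "D \<ge> 3" using N by (simp add: D_def)
  \<comment> \<open>Passing to sum and difference replaces the sum norm by the maximum norm, in
    which the bound on \<open>k\<close> and \<open>l\<close> becomes linear.\<close>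
  have sum: "\<alpha> + \<beta> = D * k + l" "\<alpha> - \<beta> = D * l - k" unfolding A B D_def by (auto simp: algebra_simps)
  have 1: "\<bar>D * k + l\<bar> \<le> D - 1" "\<bar>D * l - k\<bar> \<le> D - 1"
    unfolding sum[symmetric] using bnd unfolding D_def by linarith+
  have "D * \<bar>k\<bar> \<le> D - 1 + \<bar>l\<bar>" "D * \<bar>l\<bar> \<le> D - 1 + \<bar>k\<bar>"
    using 1 D abs_mult[of D k] abs_mult[of D l] by auto
  hence "(D - 1) * (\<bar>k\<bar> + \<bar>l\<bar>) \<le> (D - 1) * 2" by (simp add: algebra_simps)
  hence le2: "\<bar>k\<bar> + \<bar>l\<bar> \<le> 2" using D by (simp only: mult_le_cancel_left)
  hence "k = -2 \<or> k = -1 \<or> k = 0 \<or> k = 1 \<or> k = 2" "l = -2 \<or> l = -1 \<or> l = 0 \<or> l = 1 \<or> l = 2"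
    by linarith+
  hence "k = 0 \<and> l = 0" using 1 D le2 by (elim disjE) simp_all
  hence "\<alpha> = 0" "\<beta> = 0" using A B by auto
  thus ?thesis by (simp add: st \<alpha>_def \<beta>_def)
qed

text \<open>The diamond has exactly as many points as there are residues, so injectivity modulo
  \<open>M\<close> gives surjectivity.\<close>

lemma coordQ_cover:
  assumes n: "n > 0"
  shows "\<exists>t\<in>diamond n. \<exists>k. j = coordQ n t + (2 * int n ^ 2 + 2 * int n + 1) * k"
proof -
  define M where "M = 2 * int n ^ 2 + 2 * int n + 1"
  have M: "M > 0" "nat M = 2 * n ^ 2 + 2 * n + 1" unfolding M_def by (auto simp: nat_eq_iff)
  have inj: "inj_on (\<lambda>t. coordQ n t mod M) (diamond n)"
  proof (rule inj_onI)
    fix s t assume *: "s \<in> diamond n" "t \<in> diamond n" "coordQ n s mod M = coordQ n t mod M"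
    thus "s = t" using coordQ_inj[OF n *(2,1)] unfolding M_def[symmetric]
      by (simp add: mod_eq_dvd_iff)
  qed
  have "(\<lambda>t. coordQ n t mod M) ` diamond n = {0..<M}"
    using M card_image[OF inj] card_diamond[OF n] by (intro card_subset_eq) auto
  hence "j mod M \<in> (\<lambda>t. coordQ n t mod M) ` diamond n" using M by simp
  then obtain t where t: "t \<in> diamond n" "j mod M = coordQ n t mod M" by auto
  hence "M dvd j - coordQ n t" by (simp add: mod_eq_dvd_iff)
  then obtain k where "j - coordQ n t = M * k" by blast
  hence "j = coordQ n t + M * k" by simp
  thus ?thesis using t unfolding M_def by blast
qed

lemma place_power_int:
  assumes v: "v \<in> places K"
  shows "v (a powi n) = n * v a"
  by (cases n rule: int_cases2)
     (simp_all add: power_int_minus place_inverse[OF v] place_power[OF v])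

section \<open>Discrepancies indexed by the diamond, and functions supported in \<open>P\<close> and
  \<open>Q\<close>\<close>

context suzuki_points
begin

lemma disc_diamond:
  assumes "t \<in> diamond q0"
  shows "disc (coordP q0 t) (coordQ q0 t)"
proof -
  have "t \<in> to_diamond q0 ` rectangles q0"
    using assms bij_betw_imp_surj_on[OF bij_to_diamond[OF q0_pos]] by simp
  then obtain s where s: "s \<in> rectangles q0" "t = to_diamond q0 s" by blast
  note nz = x_nonzero y_nonzero P_values(5)
  define f where "f = (\<lambda>i j. x ^ i * z ^ j)"
  have fR: "f i j \<in> coord_ring" for i j
    unfolding f_def by (intro coord_ring.mult coord_ring_power coord_ring.x z_in_coord_ring)
  have f0: "f i j \<noteq> 0" for i j using nz by (simp add: f_def)
  have reg_f: "reg (f i j)" "reg (y * f i j)" for i j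
    using fR f0 nz by (auto intro!: reg_coord_ring coord_ring.mult coord_ring.y)
  have val_f: "P (f i j) = - (int i * int q + int j * (int q + 2 * int q0))"
    "Q (f i j) = int i + int j * (2 * int q0 + 1)" for i j
  proof -
    have "P (f i j) = int i * P x + int j * P z" "Q (f i j) = int i * Q x + int j * Q z"
      using nz by (auto simp: f_def place_mult[OF P] place_power[OF P] place_mult[OF Q_place]
          place_power[OF Q_place])
    thus "P (f i j) = - (int i * int q + int j * (int q + 2 * int q0))"
      "Q (f i j) = int i + int j * (2 * int q0 + 1)"
      unfolding P_values(1,3) Q_values(1,3) by (auto simp: algebra_simps)
  qed
  have val_yf: "P (y * f i j) = P (f i j) - (int q + int q0)" "Q (y * f i j) = Q (f i j) + (int q0 + 1)" for i j
    using f0[of i j] nz P_values Q_values by (auto simp: place_mult[OF P] place_mult[OF Q_place])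
  show ?thesis
  proof (cases s)
    case (Inl ij)
    obtain i j where ij: "ij = (i, j)" by (cases ij)
    have le: "i \<le> q0" "j \<le> q0" using s(1) by (auto simp: Inl ij rectangles_def)
    have t: "t = (int i + int j - int q0, int i - int j)" by (simp add: s(2) Inl ij to_diamond_def)
    \<comment> \<open>The exponents are complementary: the product of the two witnesses is
      \<open>(x * z) ^ q0\<close>, whose orders at \<open>P\<close> and \<open>Q\<close> are the
      constants in \<open>disc_dual\<close>.\<close>
    show ?thesis
    proof (rule disc_dual[OF reg_f(1)[of i j] _ _ reg_f(1)[of "q0 - i" "q0 - j"]])
    qed (use le in \<open>simp_all add: val_f t coordP_def coordQ_def of_nat_diff power2_eq_square algebra_simps\<close>)
  next
    case (Inr ij)
    obtain i j where ij: "ij = (i, j)" by (cases ij)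
    have le: "i \<le> q0 - 1" "j \<le> q0 - 1" using s(1) by (auto simp: Inr ij rectangles_def)
    define i' where "i' = q0 - 1 - i"
    define j' where "j' = q0 - 1 - j"
    have ij': "int i' = int q0 - 1 - int i" "int j' = int q0 - 1 - int j"
      using le q0_pos by (auto simp: i'_def j'_def of_nat_diff)
    have t: "t = (int i + int j + 1 - int q0, int i - int j)" by (simp add: s(2) Inr ij to_diamond_def)
    \<comment> \<open>Here the product is \<open>y ^ 2 * (x * z) ^ (q0 - 1)\<close>. Since
      \<open>y ^ 2\<close> and \<open>x * z\<close> have the same orders at \<open>P\<close> and at
      \<open>Q\<close>, the constants are the same.\<close>
    show ?thesis
    proof (rule disc_dual[OF reg_f(2)[of i j] _ _ reg_f(2)[of i' j']])
    qed (simp_all add: val_yf val_f ij' t coordP_def coordQ_def power2_eq_square algebra_simps)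
  qed
qed

lemma int_m: "int m = 2 * int q0 ^ 2 + 2 * int q0 + 1"
  by simp

lemma disc_shift_w:
  assumes "disc i j"
  shows "disc (i - int m * k) (j + int m * k)"
proof -
  define h where "h = w powi (- k)"
  have w0: "w \<noteq> 0" by (rule P_values(6))
  have "disc (i - P h) (j - Q h)"
  proof (rule disc_shift)
    show "v h = 0" if "v \<in> places K" "v \<noteq> P" "v \<noteq> Q" for v
      unfolding h_def place_power_int[OF that(1)] by (simp add: w_no_other_zeros[OF that])
  qed (use w0 assms in \<open>auto simp: h_def\<close>)
  moreover have "P h = int m * k" "Q h = - (int m * k)"
    unfolding h_def place_power_int[OF P] place_power_int[OF Q_place] P_values(4) Q_values(4)
    by (simp_all add: algebra_simps)
  ultimately show ?thesis by simp
qed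

lemma disc_cover:
  assumes "disc i j"
  shows "\<exists>t\<in>diamond q0. \<exists>k. i = coordP q0 t - int m * k \<and> j = coordQ q0 t + int m * k"
proof -
  obtain t k where t: "t \<in> diamond q0" "j = coordQ q0 t + int m * k"
    using coordQ_cover[OF q0_pos, of j] unfolding int_m[symmetric] by blast
  have "disc (coordP q0 t - int m * k) j"
    unfolding t(2) by (rule disc_shift_w[OF disc_diamond[OF t(1)]])
  thus ?thesis using disc_unique[OF assms] t by blast
qed

text \<open>In place of a degree formula, \<open>h ^ m\<close> and a power of \<open>w\<close> move
  the discrepancy (0, 0) to (- m (P h + Q h), 0), and uniqueness makes the first entry 0. Moving (0,
  0) by \<open>h\<close> alone then gives a listed divisor of degree 0, up to a power of
  \<open>w\<close>.\<close>

lemma two_point_principal: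
  assumes h: "h \<noteq> 0" "\<And>v. v \<in> places K \<Longrightarrow> v \<noteq> P \<Longrightarrow> v \<noteq> Q \<Longrightarrow> v h = 0"
  shows "P h = - Q h" "int m dvd Q h"
proof -
  have "(- int q0, 0) \<in> diamond q0" by (simp add: diamond_def)
  from disc_diamond[OF this] have disc0: "disc 0 0" by (simp add: coordP_def coordQ_def)
  have hm: "h ^ m \<noteq> 0" using h by simp
  have "disc (0 - P (h ^ m)) (0 - Q (h ^ m))"
  proof (rule disc_shift[OF hm _ disc0])
    show "v (h ^ m) = 0" if "v \<in> places K" "v \<noteq> P" "v \<noteq> Q" for v
      unfolding place_power[OF that(1)] h(2)[OF that] by simp
  qed
  from disc_shift_w[OF this, of "Q h"]
  have "disc (- (int m * (P h + Q h))) 0"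
    by (simp only: place_power[OF P] place_power[OF Q_place]) (simp add: algebra_simps)
  hence "int m * (P h + Q h) = 0" using disc_unique[OF disc0] by fastforce
  moreover have "int m \<noteq> 0" by (simp only: of_nat_eq_0_iff)
  ultimately have "P h + Q h = 0" by (metis mult_eq_0_iff)
  thus PQ: "P h = - Q h" by simp
  have "disc (0 - P h) (0 - Q h)" by (rule disc_shift[OF h(1) _ disc0]) (rule h(2))
  then obtain t k where t: "t \<in> diamond q0" "0 - P h = coordP q0 t - int m * k"
    "0 - Q h = coordQ q0 t + int m * k" using disc_cover by blast
  obtain a b where ab: "t = (a, b)" by (cases t)
  have "coordP q0 t + coordQ q0 t = 0" using t(2,3) PQ by simp
  \<comment> \<open>E(a,b) has degree (a + q0) (m - 2 (q0 + 1)), and the second factor equals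
    \<open>2 * (int q0 * int q0) - 1\<close>, an odd number.\<close>
  hence "(a + int q0) * (2 * (int q0 * int q0) - 1) = 0"
    by (simp add: ab coordP_def coordQ_def power2_eq_square algebra_simps)
  moreover have "2 * (int q0 * int q0) - 1 \<noteq> 0" by presburger
  ultimately have "a = - int q0" by simp
  moreover from this have "b = 0" using t(1) by (simp add: ab diamond_def)
  ultimately have "coordQ q0 t = 0" by (simp add: ab coordQ_def)
  hence "Q h = int m * (- k)" using t(3) by simp
  thus "int m dvd Q h" by (rule dvdI)
qed

end

section \<open>Divisor classes\<close>

lemma divisors_add: "A \<in> divisors K \<Longrightarrow> B \<in> divisors K \<Longrightarrow> A + B \<in> divisors K"
  unfolding divisors_def using Poly_Mapping.keys_add[of A B] by blast

lemma divisors_uminus: "A \<in> divisors K \<Longrightarrow> - A \<in> divisors K"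
  by (simp add: divisors_def)

lemma divisors_diff: "A \<in> divisors K \<Longrightarrow> B \<in> divisors K \<Longrightarrow> A - B \<in> divisors K"
  using divisors_add[of A K "- B"] divisors_uminus[of B K] by simp

lemma divisors_cmul: "A \<in> divisors K \<Longrightarrow> frag_cmul n A \<in> divisors K"
  unfolding divisors_def using keys_cmul[of n A] by blast

lemma divisors_of: "v \<in> places K \<Longrightarrow> frag_of v \<in> divisors K"
  by (simp add: divisors_def)

lemma principal_iff:
  "D \<in> principal_divisors K \<longleftrightarrow>
     D \<in> divisors K \<and> (\<exists>f. f \<noteq> 0 \<and> (\<forall>v\<in>places K. Poly_Mapping.lookup D v = v f))"
  by (simp add: principal_divisors_def)

lemma principal_add:
  assumes "D \<in> principal_divisors K" "D' \<in> principal_divisors K"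
  shows "D + D' \<in> principal_divisors K"
proof -
  obtain f g where "f \<noteq> 0" "\<forall>v\<in>places K. Poly_Mapping.lookup D v = v f"
    "g \<noteq> 0" "\<forall>v\<in>places K. Poly_Mapping.lookup D' v = v g"
    using assms by (auto simp: principal_iff)
  thus ?thesis using assms unfolding principal_iff
    by (intro conjI divisors_add exI[of _ "f * g"]) (auto simp: lookup_add place_mult)
qed

lemma principal_cmul:
  assumes "D \<in> principal_divisors K"
  shows "frag_cmul n D \<in> principal_divisors K"
proof -
  obtain f where "f \<noteq> 0" "\<forall>v\<in>places K. Poly_Mapping.lookup D v = v f"
    using assms by (auto simp: principal_iff)
  thus ?thesis using assms unfolding principal_iff
    by (intro conjI divisors_cmul exI[of _ "f powi n"]) (auto simp: place_power_int)
qed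

lemma principal_uminus: "D \<in> principal_divisors K \<Longrightarrow> - D \<in> principal_divisors K"
  using principal_cmul[of D K "-1"] by simp

lemma equiv_lin_equiv: "equiv (divisors K) (lin_equiv K)"
proof (rule equivI)
  show "lin_equiv K \<subseteq> divisors K \<times> divisors K" by (auto simp: lin_equiv_def)
  have "0 \<in> principal_divisors K" unfolding principal_iff
    by (intro conjI exI[of _ 1]) (auto simp: divisors_def place_one)
  thus "refl_on (divisors K) (lin_equiv K)" by (auto simp: refl_on_def lin_equiv_def)
  show "sym (lin_equiv K)"
  proof (rule symI)
    fix A B assume "(A, B) \<in> lin_equiv K"
    thus "(B, A) \<in> lin_equiv K" using principal_uminus[of "A - B" K] by (auto simp: lin_equiv_def)
  qed
  show "trans (lin_equiv K)"
  proof (rule transI)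
    fix A B C assume "(A, B) \<in> lin_equiv K" "(B, C) \<in> lin_equiv K"
    thus "(A, C) \<in> lin_equiv K" using principal_add[of "A - B" K "B - C"] by (auto simp: lin_equiv_def)
  qed
qed

lemma divisor_class_eq_iff:
  "A \<in> divisors K \<Longrightarrow> B \<in> divisors K \<Longrightarrow>
     divisor_class K A = divisor_class K B \<longleftrightarrow> (A, B) \<in> lin_equiv K"
  unfolding divisor_class_def by (rule eq_equiv_class_iff[OF equiv_lin_equiv])

text \<open>L(A - P) is contained in L(A), so the spaces differ exactly when some function attains
  the bound at \<open>P\<close>.\<close>

lemma riemann_roch_space_neq_iff:
  assumes P: "P \<in> places K"
  shows "riemann_roch_space K A \<noteq> riemann_roch_space K (A - frag_of P) \<longleftrightarrow>
    (\<exists>f. f \<noteq> 0 \<and> (\<forall>v\<in>places K. 0 \<le> v f + Poly_Mapping.lookup A v) \<and> P f = - Poly_Mapping.lookup A P)"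
proof -
  have lk: "Poly_Mapping.lookup (A - frag_of P) v = Poly_Mapping.lookup A v - (if v = P then 1 else 0)" for v
    by (auto simp: lookup_minus lookup_single when_def)
  have sub: "riemann_roch_space K (A - frag_of P) \<subseteq> riemann_roch_space K A"
  proof -
    have "v f + Poly_Mapping.lookup (A - frag_of P) v \<le> v f + Poly_Mapping.lookup A v" for v f
      by (simp add: lk)
    thus ?thesis unfolding riemann_roch_space_def using order_trans by blast
  qed
  have "f \<in> riemann_roch_space K A - riemann_roch_space K (A - frag_of P) \<longleftrightarrow>
    f \<noteq> 0 \<and> (\<forall>v\<in>places K. 0 \<le> v f + Poly_Mapping.lookup A v) \<and> P f = - Poly_Mapping.lookup A P" for f
  proof -
    have 1: "f \<in> riemann_roch_space K B \<longleftrightarrow> f = 0 \<or> (\<forall>v\<in>places K. 0 \<le> v f + Poly_Mapping.lookup B v)" for B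
      by (auto simp: riemann_roch_space_def)
    have 2: "(\<forall>v\<in>places K. 0 \<le> v f + Poly_Mapping.lookup (A - frag_of P) v) \<longleftrightarrow>
      (\<forall>v\<in>places K. 0 \<le> v f + Poly_Mapping.lookup A v) \<and> 1 \<le> P f + Poly_Mapping.lookup A P"
    proof (intro iffI conjI ballI)
      assume *: "\<forall>v\<in>places K. 0 \<le> v f + Poly_Mapping.lookup (A - frag_of P) v"
      show "1 \<le> P f + Poly_Mapping.lookup A P" using bspec[OF * P] by (simp add: lk)
      show "0 \<le> v f + Poly_Mapping.lookup A v" if "v \<in> places K" for v
        using bspec[OF * that] by (simp add: lk split: if_splits)
    next
      fix v assume *: "(\<forall>v\<in>places K. 0 \<le> v f + Poly_Mapping.lookup A v) \<and> 1 \<le> P f + Poly_Mapping.lookup A P"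
        and v: "v \<in> places K"
      have "0 \<le> v f + Poly_Mapping.lookup A v" using * v by blast
      thus "0 \<le> v f + Poly_Mapping.lookup (A - frag_of P) v" using * by (simp add: lk)
    qed
    have 3: "0 \<le> P f + Poly_Mapping.lookup A P" if "\<forall>v\<in>places K. 0 \<le> v f + Poly_Mapping.lookup A v"
      using that P by blast
    have 4: "\<not> 1 \<le> P f + Poly_Mapping.lookup A P \<longleftrightarrow> P f = - Poly_Mapping.lookup A P"
      if "0 \<le> P f + Poly_Mapping.lookup A P" using that by linarith
    show ?thesis unfolding Diff_iff 1 2 using 3 4 by blast
  qed
  thus ?thesis using sub by blast
qed

section \<open>Passage from pairs of integers to divisor classes\<close>

context suzuki_points
begin

definition two_point :: "int \<Rightarrow> int \<Rightarrow> 'a divisor" where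
  "two_point i j = frag_cmul i (frag_of P) + frag_cmul j (frag_of Q)"

lemma two_point_divisor: "two_point i j \<in> divisors K"
  unfolding two_point_def by (intro divisors_add divisors_cmul divisors_of P Q_place)

lemma lookup_two_point:
  "Poly_Mapping.lookup (two_point i j) v = (if v = P then i else if v = Q then j else 0)"
  using P_neq_Q by (auto simp: two_point_def lookup_add lookup_single when_def)

text \<open>Multiplication by a function \<open>h\<close> with divisor A - (i P + j Q) carries the
  Riemann-Roch spaces of one divisor to those of the other.\<close>

lemma discrepancy_iff_disc:
  assumes "(A, two_point i j) \<in> lin_equiv K"
  shows "riemann_roch_space K A \<noteq> riemann_roch_space K (A - frag_of P) \<and>
     riemann_roch_space K (A - frag_of Q) = riemann_roch_space K (A - frag_of Q - frag_of P) \<longleftrightarrow>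
     disc i j"
proof -
  obtain h where h: "h \<noteq> 0" "\<And>v. v \<in> places K \<Longrightarrow> Poly_Mapping.lookup (A - two_point i j) v = v h"
    using assms unfolding lin_equiv_def principal_divisors_def by auto
  have A: "Poly_Mapping.lookup A v = v h + Poly_Mapping.lookup (two_point i j) v" if "v \<in> places K" for v
    using h(2)[OF that] by (simp add: lookup_minus)
  \<comment> \<open>Both A and A - Q have to be treated, hence the free divisor \<open>B\<close> and
    the free coefficient \<open>l\<close>, used with \<open>j\<close> and
    \<open>j - 1\<close>.\<close>
  have key: "(\<exists>f. f \<noteq> 0 \<and> (\<forall>v\<in>places K. 0 \<le> v f + Poly_Mapping.lookup B v) \<and> P f = - Poly_Mapping.lookup B P)
      \<longleftrightarrow> (\<exists>f. reg f \<and> P f = - i \<and> Q f \<ge> - l)"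
    if B: "\<And>v. v \<in> places K \<Longrightarrow> Poly_Mapping.lookup B v = v h + (if v = P then i else if v = Q then l else 0)" for B l
  proof
    assume "\<exists>f. f \<noteq> 0 \<and> (\<forall>v\<in>places K. 0 \<le> v f + Poly_Mapping.lookup B v) \<and> P f = - Poly_Mapping.lookup B P"
    then obtain f where f: "f \<noteq> 0" "\<And>v. v \<in> places K \<Longrightarrow> 0 \<le> v f + Poly_Mapping.lookup B v"
      "P f = - Poly_Mapping.lookup B P" by blast
    have "reg (f * h)" unfolding reg_def
      using f(1,2) h(1) B by (fastforce simp: place_mult)
    moreover have "P (f * h) = - i" using f h(1) B[OF P] by (simp add: place_mult[OF P])
    moreover have "Q (f * h) \<ge> - l"
      using f(1) f(2)[OF Q_place] h(1) B[OF Q_place] P_neq_Q by (auto simp: place_mult[OF Q_place])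
    ultimately show "\<exists>f. reg f \<and> P f = - i \<and> Q f \<ge> - l" by blast
  next
    assume "\<exists>f. reg f \<and> P f = - i \<and> Q f \<ge> - l"
    then obtain f where f: "reg f" "P f = - i" "Q f \<ge> - l" by blast
    have f0: "f \<noteq> 0" using f(1) by (simp add: reg_def)
    have "0 \<le> v (f / h) + Poly_Mapping.lookup B v" if "v \<in> places K" for v
      unfolding place_divide[OF that f0 h(1)] B[OF that] using f that by (auto simp: reg_def)
    moreover have "P (f / h) = - Poly_Mapping.lookup B P"
      unfolding place_divide[OF P f0 h(1)] B[OF P] using f(2) by simp
    ultimately show "\<exists>f. f \<noteq> 0 \<and> (\<forall>v\<in>places K. 0 \<le> v f + Poly_Mapping.lookup B v) \<and>
        P f = - Poly_Mapping.lookup B P"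
      using f0 h(1) by (intro exI[of _ "f / h"]) auto
  qed
  have 1: "riemann_roch_space K A \<noteq> riemann_roch_space K (A - frag_of P) \<longleftrightarrow>
      (\<exists>f. reg f \<and> P f = - i \<and> Q f \<ge> - j)"
    unfolding riemann_roch_space_neq_iff[OF P] by (rule key) (simp add: A lookup_two_point)
  have 2: "riemann_roch_space K (A - frag_of Q) \<noteq> riemann_roch_space K (A - frag_of Q - frag_of P) \<longleftrightarrow>
      (\<exists>f. reg f \<and> P f = - i \<and> Q f \<ge> - (j - 1))"
    unfolding riemann_roch_space_neq_iff[OF P] using P_neq_Q
    by (intro key) (auto simp: A lookup_two_point lookup_minus lookup_single when_def)
  have "- (j - 1) = - j + 1" by simp
  thus ?thesis unfolding disc_def using 1 2 by metis
qed

text \<open>Only the \<open>Q\<close>-coordinates are compared, since modulo \<open>m\<close> they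
  already separate the points of the diamond.\<close>

lemma two_point_equiv:
  assumes "(two_point i j, two_point i' j') \<in> lin_equiv K"
  shows "int m dvd j - j'"
proof -
  obtain h where h: "h \<noteq> 0"
    "\<And>v. v \<in> places K \<Longrightarrow> Poly_Mapping.lookup (two_point i j - two_point i' j') v = v h"
    using assms unfolding lin_equiv_def principal_divisors_def by auto
  have val: "v h = Poly_Mapping.lookup (two_point i j) v - Poly_Mapping.lookup (two_point i' j') v"
    if "v \<in> places K" for v using h(2)[OF that] unfolding lookup_minus by (rule sym)
  have "int m dvd Q h"
  proof (rule two_point_principal(2)[OF h(1)])
    show "v h = 0" if "v \<in> places K" "v \<noteq> P" "v \<noteq> Q" for v
      unfolding val[OF that(1)] lookup_two_point using that by simp
  qed
  moreover have "Q h = j - j'" unfolding val[OF Q_place] lookup_two_point using P_neq_Q by simp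
  ultimately show ?thesis by (simp only:)
qed

lemma two_point_shift: "(two_point (i - int m * k) (j + int m * k), two_point i j) \<in> lin_equiv K"
proof -
  have w0: "w \<noteq> 0" by (rule P_values(6))
  have "Poly_Mapping.lookup (two_point (i - int m * k) (j + int m * k) - two_point i j) v = v (w powi k)"
    if v: "v \<in> places K" for v
  proof -
    have vw: "v w = (if v = P then - int m else if v = Q then int m else 0)"
    proof (cases "v = P")
      case True
      thus ?thesis using P_values(4) by simp
    next
      case False
      thus ?thesis using Q_values(4) w_no_other_zeros[OF v False]
        by (cases "v = Q") simp_all
    qed
    show ?thesis unfolding place_power_int[OF v] lookup_minus lookup_two_point vw
      by (simp add: algebra_simps)
  qed
  hence "two_point (i - int m * k) (j + int m * k) - two_point i j \<in> principal_divisors K"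
    unfolding principal_iff using w0
    by (intro conjI exI[of _ "w powi k"] divisors_diff two_point_divisor) auto
  thus ?thesis by (simp add: lin_equiv_def two_point_divisor)
qed

text \<open>\<open>H\<close> may be any representative of its class, so \<open>E t\<close> equals
  the two-point divisor with coordinates \<open>coordP\<close>, \<open>coordQ\<close> only up to a
  multiple of the principal divisor H - m P.\<close>

lemma bij_discrepancies:
  assumes H: "H \<in> divisor_class K (frag_cmul (int m) (frag_of P))"
    and E: "\<And>a b. E (a, b) = frag_cmul (a + int q0) H
      - frag_cmul ((a + int q0) * (int q0 + 1) + b * int q0) (frag_of P)
      - frag_cmul ((a + int q0) * (int q0 + 1) - b * int q0) (frag_of Q)"
  shows "bij_betw (\<lambda>t. divisor_class K (E t)) (diamond q0) (two_point_discrepancies K P Q)"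
proof -
  have mPH: "(frag_cmul (int m) (frag_of P), H) \<in> lin_equiv K"
    using H by (simp add: divisor_class_def)
  hence Hd: "H \<in> divisors K" and pr: "H - frag_cmul (int m) (frag_of P) \<in> principal_divisors K"
    using principal_uminus[of "frag_cmul (int m) (frag_of P) - H" K] by (auto simp: lin_equiv_def)
  have Ed: "E t \<in> divisors K" for t
    by (cases t) (auto simp: E intro!: divisors_diff divisors_cmul Hd divisors_of P Q_place)
  have eq: "(E t, two_point (coordP q0 t) (coordQ q0 t)) \<in> lin_equiv K" for t
  proof -
    obtain a b where ab: "t = (a, b)" by (cases t)
    have "E t - two_point (coordP q0 t) (coordQ q0 t) =
      frag_cmul (a + int q0) (H - frag_cmul (int m) (frag_of P))"
      by (rule poly_mapping_eqI)
         (simp add: ab E two_point_def coordP_def coordQ_def lookup_add lookup_minus algebra_simps power2_eq_square)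
    thus ?thesis using principal_cmul[OF pr] Ed two_point_divisor by (simp add: lin_equiv_def)
  qed
  have cls: "divisor_class K (E t) = divisor_class K (two_point (coordP q0 t) (coordQ q0 t))" for t
    using eq divisor_class_eq_iff[OF Ed two_point_divisor] by blast
  show ?thesis
  proof (rule bij_betw_imageI)
    show "inj_on (\<lambda>t. divisor_class K (E t)) (diamond q0)"
    proof (rule inj_onI)
      fix s t assume st: "s \<in> diamond q0" "t \<in> diamond q0" "divisor_class K (E s) = divisor_class K (E t)"
      hence "(two_point (coordP q0 t) (coordQ q0 t), two_point (coordP q0 s) (coordQ q0 s)) \<in> lin_equiv K"
        unfolding cls using divisor_class_eq_iff[OF two_point_divisor two_point_divisor] by metis
      from two_point_equiv[OF this, unfolded int_m] show "s = t"
        by (rule coordQ_inj[OF q0_pos st(1,2)])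
    qed
    show "(\<lambda>t. divisor_class K (E t)) ` diamond q0 = two_point_discrepancies K P Q"
    proof (intro equalityI subsetI)
      fix C assume "C \<in> (\<lambda>t. divisor_class K (E t)) ` diamond q0"
      then obtain t where t: "t \<in> diamond q0" "C = divisor_class K (E t)" by blast
      have "C \<in> discrepancies K P Q" unfolding discrepancies_def t(2)
        using discrepancy_iff_disc[OF eq[of t]] disc_diamond[OF t(1)] Ed by blast
      thus "C \<in> two_point_discrepancies K P Q"
        unfolding two_point_discrepancies_def t(2) cls two_point_def by blast
    next
      fix C assume "C \<in> two_point_discrepancies K P Q"
      then obtain A i j where A: "A \<in> divisors K" "C = divisor_class K A"
        "riemann_roch_space K A \<noteq> riemann_roch_space K (A - frag_of P)"
        "riemann_roch_space K (A - frag_of Q) = riemann_roch_space K (A - frag_of Q - frag_of P)"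
        "C = divisor_class K (two_point i j)"
        unfolding two_point_discrepancies_def discrepancies_def two_point_def by blast
      have "(A, two_point i j) \<in> lin_equiv K"
        using divisor_class_eq_iff[OF A(1) two_point_divisor] A(2,5) by blast
      hence "disc i j" using discrepancy_iff_disc A(3,4) by blast
      then obtain t k where t: "t \<in> diamond q0" "i = coordP q0 t - int m * k" "j = coordQ q0 t + int m * k"
        using disc_cover by blast
      have "C = divisor_class K (E t)" unfolding A(5) cls t(2,3)
        using divisor_class_eq_iff[OF two_point_divisor two_point_divisor] two_point_shift by blast
      thus "C \<in> (\<lambda>t. divisor_class K (E t)) ` diamond q0" using t(1) by blast
    qed
  qed
qed

end

theorem theorem10p2:
  fixes q0 q m :: nat
    and K :: "'f::field set"
    and x y :: 'f
    and P Q :: "'f \<Rightarrow> int"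
    and H E0 E1 E2 :: "'f divisor"
    and I :: "(nat \<times> nat + nat \<times> nat) set"
    and R :: "nat \<times> nat + nat \<times> nat \<Rightarrow> 'f divisor"
    and T :: "(int \<times> int) set"
    and E :: "int \<times> int \<Rightarrow> 'f divisor"
  defines "q \<equiv> 2 * q0 ^ 2"
    and "m \<equiv> q + 2 * q0 + 1"
  assumes q0: "\<exists>s::nat. q0 = 2 ^ s"
    and X: "suzuki_function_field q0 K x y"
    and P: "P \<in> rational_places K"
    and Q: "Q \<in> rational_places K"
    and PQ: "P \<noteq> Q"
    and H: "H \<in> divisor_class K (frag_cmul (int m) (frag_of P))"
  defines "E0 \<equiv> H - frag_cmul (2 * int q0 + 1) (frag_of P) - frag_of Q"
    and "E1 \<equiv> H - frag_cmul (int q0 + 1) (frag_of P + frag_of Q)"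
    and "E2 \<equiv> H - frag_of P - frag_cmul (2 * int q0 + 1) (frag_of Q)"
    and "I \<equiv> ({0..q0} \<times> {0..q0}) <+> ({0..q0 - 1} \<times> {0..q0 - 1})"
    and "R \<equiv> case_sum
           (\<lambda>(i, j). frag_cmul (int i) E0 + frag_cmul (int j) E2)
           (\<lambda>(i, j). E1 + frag_cmul (int i) E0 + frag_cmul (int j) E2)"
    and "T \<equiv> {(a, b). \<bar>a\<bar> + \<bar>b\<bar> \<le> int q0}"
    and "E \<equiv> (\<lambda>(a, b). frag_cmul (a + int q0) H
           - frag_cmul ((a + int q0) * (int q0 + 1) + b * int q0) (frag_of P)
           - frag_cmul ((a + int q0) * (int q0 + 1) - b * int q0) (frag_of Q))"
  shows "card (two_point_discrepancies K P Q) = m \<and>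
         bij_betw (\<lambda>s. divisor_class K (R s)) I (two_point_discrepancies K P Q) \<and>
         card T = m \<and> inj_on E T \<and>
         (\<exists>\<phi>. bij_betw \<phi> I T \<and> (\<forall>s\<in>I. R s = E (\<phi> s)))"
proof -
  obtain x' y' where S: "suzuki K q0 x' y'" "P x' < 0" "Q x' > 0" "Q y' > 0"
    using exists_normalised_coordinates[OF _ P Q PQ, of q0 x y] q0 X suzuki_iff by blast
  have "P \<in> places K" using P by (simp add: rational_places_def)
  then interpret suzuki_points K q0 x' y' P Q
    using S Q by (simp add: suzuki_points_def suzuki_points_axioms_def)
  have m_eq: "m = 2 * q0 ^ 2 + 2 * q0 + 1" by (simp add: m_def q_def)
  have T: "T = diamond q0" by (simp add: T_def diamond_def)
  have I: "I = rectangles q0" by (simp add: I_def rectangles_def)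
  have bij: "bij_betw (\<lambda>t. divisor_class K (E t)) T (two_point_discrepancies K P Q)"
    unfolding T using H unfolding m_eq by (rule bij_discrepancies) (simp add: E_def)
  have phi: "bij_betw (to_diamond q0) I T" unfolding I T by (rule bij_to_diamond[OF q0_pos])
  \<comment> \<open>This is an equality of divisors, not only of classes, and holds whatever
    representative \<open>H\<close> is chosen.\<close>
  have RE: "R s = E (to_diamond q0 s)" for s
  proof (cases s)
    case (Inl ij)
    obtain i j where ij: "ij = (i, j)" by (cases ij)
    show ?thesis
      by (rule poly_mapping_eqI)
         (simp add: Inl ij R_def E_def to_diamond_def E0_def E2_def lookup_add lookup_minus algebra_simps)
  next
    case (Inr ij)
    obtain i j where ij: "ij = (i, j)" by (cases ij)
    show ?thesis
      by (rule poly_mapping_eqI)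
         (simp add: Inr ij R_def E_def to_diamond_def E0_def E1_def E2_def lookup_add lookup_minus algebra_simps)
  qed
  have "bij_betw (\<lambda>s. divisor_class K (R s)) I (two_point_discrepancies K P Q)"
    using bij_betw_trans[OF phi bij] by (simp add: RE comp_def)
  moreover have card_T: "card T = m" unfolding T m_eq by (rule card_diamond(1)[OF q0_pos])
  moreover have "card (two_point_discrepancies K P Q) = m"
    using bij_betw_same_card[OF bij] card_T by simp
  \<comment> \<open>Even the classes of these divisors are pairwise distinct.\<close>
  moreover have "inj_on E T"
    using inj_on_imageI2[of "divisor_class K" E T] bij by (simp add: bij_betw_def comp_def)
  ultimately show ?thesis using phi RE by blast
qed

end
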